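(* Let $(M,\omega)$ be a symplectic manifold of dimension $2n$ with $n > 2$. Then for every integer $k$ with $0 < k < n$ we have $$\mathrm{Diff}_{0}(M,\omega^{k}) = \mathrm{Symp}_{0}(M,\omega).$$
   Context: A symplectic manifold $(M,\omega)$ is a smooth manifold $M$ with a closed non-degenerate $2$-form $\omega$; $M$ is not assumed compact. Here $\omega^{k}=\omega\wedge\dots\wedge\omega$ ($k$ factors). For $1\le k\le n$, $\mathrm{Diff}(M,\omega^{k})$ denotes the group of all smooth diffeomorphisms $\phi$ of $M$ with $\phi^{*}\omega^{k}=\omega^{k}$, and $\mathrm{Diff}_{0}(M,\omega^{k})$ denotes its identity component, i.e. the set of those $f\in \mathrm{Diff}(M,\omega^{k})$ for which there is a smooth family of diffeomorphisms $f_{t}\in\mathrm{Diff}(M,\omega^{k})$, $t\in[0,1]$ (smooth as a map $M\times[0,1]\to M$), with $f_{0}=\mathrm{id}$ and $f_{1}=f$. $\mathrm{Symp}(M,\omega)=\mathrm{Diff}(M,\omega)$ is the group of diffeomorphisms preserving $\omega$, and $\mathrm{Symp}_{0}(M,\omega)=\mathrm{Diff}_{0}(M,\omega)$ is its identity component in the same sense. *)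

theory Defs
  imports "HOL-Analysis.Analysis" "HOL-Combinatorics.Permutations"
begin

section \<open>Smooth maps between Euclidean spaces\<close>

text \<open>\<open>Ck_on k S f\<close> is meant for open \<open>S\<close>; in finite dimension it suffices to control the
  directional derivatives.\<close>

primrec Ck_on ::
  "nat \<Rightarrow> 'a::euclidean_space set \<Rightarrow> ('a \<Rightarrow> 'b::euclidean_space) \<Rightarrow> bool" where
  "Ck_on 0 S f \<longleftrightarrow> continuous_on S f"
| "Ck_on (Suc k) S f \<longleftrightarrow>
     (\<forall>x\<in>S. f differentiable (at x)) \<and>
     (\<forall>v. Ck_on k S (\<lambda>x. frechet_derivative f (at x) v))"

text \<open>On an arbitrary set, smoothness means that there are local smooth extensions to open sets.
  On open sets this is the usual notion; the general case is needed for \<open>U \<times> [0,1]\<close>.\<close>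

definition smooth_on ::
  "'a::euclidean_space set \<Rightarrow> ('a \<Rightarrow> 'b::euclidean_space) \<Rightarrow> bool" where
  "smooth_on S f \<longleftrightarrow>
     (\<forall>x\<in>S. \<exists>T g. open T \<and> x \<in> T \<and> (\<forall>k. Ck_on k T g) \<and> (\<forall>y\<in>S \<inter> T. g y = f y))"


section \<open>Smooth manifolds\<close>

text \<open>A chart is a domain together with a coordinate map; the values of the map outside the
  domain are irrelevant.  An atlas need not be maximal: all notions below depend only on the
  smooth structure that it generates.\<close>

type_synonym ('a, 'e) chart = "'a set \<times> ('a \<Rightarrow> 'e)"

definition is_chart :: "'a topology \<Rightarrow> ('a, 'e::euclidean_space) chart \<Rightarrow> bool" where
  "is_chart M c \<longleftrightarrow>
     openin M (fst c) \<and> open (snd c ` fst c) \<and>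
     homeomorphic_map (subtopology M (fst c)) (top_of_set (snd c ` fst c)) (snd c)"

definition chart_inv :: "('a, 'e) chart \<Rightarrow> 'e \<Rightarrow> 'a" where
  "chart_inv c = inv_into (fst c) (snd c)"

definition transition :: "('a, 'e) chart \<Rightarrow> ('a, 'e) chart \<Rightarrow> 'e \<Rightarrow> 'e" where
  "transition c d = snd d \<circ> chart_inv c"

definition smooth_atlas :: "'a topology \<Rightarrow> ('a, 'e::euclidean_space) chart set \<Rightarrow> bool" where
  "smooth_atlas M A \<longleftrightarrow>
     (\<forall>c\<in>A. is_chart M c) \<and> (\<Union>c\<in>A. fst c) = topspace M \<and>
     (\<forall>c\<in>A. \<forall>d\<in>A. smooth_on (snd c ` (fst c \<inter> fst d)) (transition c d))"

definition second_countable_space :: "'a topology \<Rightarrow> bool" where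
  "second_countable_space M \<longleftrightarrow>
     (\<exists>\<B>. countable \<B> \<and> (\<forall>B\<in>\<B>. openin M B) \<and>
        (\<forall>U x. openin M U \<and> x \<in> U \<longrightarrow> (\<exists>B\<in>\<B>. x \<in> B \<and> B \<subseteq> U)))"

definition smooth_manifold :: "'a topology \<Rightarrow> ('a, 'e::euclidean_space) chart set \<Rightarrow> bool" where
  "smooth_manifold M A \<longleftrightarrow>
     Hausdorff_space M \<and> second_countable_space M \<and> smooth_atlas M A"

definition smooth_map ::
  "'a topology \<Rightarrow> ('a, 'e::euclidean_space) chart set \<Rightarrow> ('a \<Rightarrow> 'a) \<Rightarrow> bool" where
  "smooth_map M A f \<longleftrightarrow>
     continuous_map M M f \<and>
     (\<forall>c\<in>A. \<forall>d\<in>A.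
        smooth_on {x \<in> snd c ` fst c. f (chart_inv c x) \<in> fst d} (snd d \<circ> f \<circ> chart_inv c))"

text \<open>Smoothness of \<open>(x, t) \<mapsto> F t x\<close> as a map from \<open>M \<times> [0,1]\<close> to \<open>M\<close>.\<close>

definition smooth_family ::
  "'a topology \<Rightarrow> ('a, 'e::euclidean_space) chart set \<Rightarrow> (real \<Rightarrow> 'a \<Rightarrow> 'a) \<Rightarrow> bool" where
  "smooth_family M A F \<longleftrightarrow>
     continuous_map (prod_topology M (top_of_set {0..1})) M (\<lambda>(x, t). F t x) \<and>
     (\<forall>c\<in>A. \<forall>d\<in>A.
        smooth_on {(x, t). x \<in> snd c ` fst c \<and> t \<in> {0..1} \<and> F t (chart_inv c x) \<in> fst d}
          (\<lambda>(x, t). snd d (F t (chart_inv c x))))"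


section \<open>Tangent vectors\<close>

text \<open>A tangent vector at \<open>p\<close> assigns to every chart around \<open>p\<close> a coordinate vector, subject to
  the usual transformation rule; the value on all other charts is \<open>0\<close> by convention.\<close>

type_synonym ('a, 'e) tvec = "('a, 'e) chart \<Rightarrow> 'e"

definition charts_at :: "('a, 'e) chart set \<Rightarrow> 'a \<Rightarrow> ('a, 'e) chart set" where
  "charts_at A p = {c \<in> A. p \<in> fst c}"

definition tangent_space ::
  "('a, 'e::euclidean_space) chart set \<Rightarrow> 'a \<Rightarrow> ('a, 'e) tvec set" where
  "tangent_space A p =
     {v. (\<forall>c. c \<notin> charts_at A p \<longrightarrow> v c = 0) \<and>
         (\<forall>c\<in>charts_at A p. \<forall>d\<in>charts_at A p.
            v d = frechet_derivative (transition c d) (at (snd c p)) (v c))}"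

text \<open>The tangent vector at \<open>p\<close> whose coordinate vector in the chart \<open>c\<close> is \<open>e\<close>.\<close>

definition coord_tvec ::
  "('a, 'e::euclidean_space) chart set \<Rightarrow> ('a, 'e) chart \<Rightarrow> 'a \<Rightarrow> 'e \<Rightarrow> ('a, 'e) tvec" where
  "coord_tvec A c p e =
     (\<lambda>d. if d \<in> charts_at A p
           then frechet_derivative (transition c d) (at (snd c p)) e else 0)"

text \<open>The differential of \<open>f\<close> at \<open>p\<close>; by the chain rule the choice of the chart \<open>c\<close> around
  \<open>p\<close> does not matter.\<close>

definition differential ::
  "('a, 'e::euclidean_space) chart set \<Rightarrow> ('a \<Rightarrow> 'a) \<Rightarrow> 'a \<Rightarrow> ('a, 'e) tvec \<Rightarrow> ('a, 'e) tvec" where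
  "differential A f p v =
     (let c = (SOME c. c \<in> charts_at A p) in
      (\<lambda>d. if d \<in> charts_at A (f p)
           then frechet_derivative (snd d \<circ> f \<circ> chart_inv c) (at (snd c p)) (v c) else 0))"


section \<open>Differential forms\<close>

text \<open>A \<open>k\<close>-form at \<open>p\<close> takes its arguments as a sequence of tangent vectors, of which only
  the entries with index below \<open>k\<close> are used.\<close>

type_synonym ('a, 'e) form = "'a \<Rightarrow> (nat \<Rightarrow> ('a, 'e) tvec) \<Rightarrow> real"

definition alternating_form ::
  "('a, 'e::euclidean_space) chart set \<Rightarrow> nat \<Rightarrow> 'a \<Rightarrow> ((nat \<Rightarrow> ('a, 'e) tvec) \<Rightarrow> real) \<Rightarrow> bool" where
  "alternating_form A k p \<eta> \<longleftrightarrow>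
     (\<forall>v w. (\<forall>i<k. v i = w i) \<longrightarrow> \<eta> v = \<eta> w) \<and>
     (\<forall>v. (\<forall>i<k. v i \<in> tangent_space A p) \<longrightarrow>
        (\<forall>i<k. \<forall>u\<in>tangent_space A p. \<forall>w\<in>tangent_space A p. \<forall>a b.
           \<eta> (v(i := (\<lambda>c. a *\<^sub>R u c + b *\<^sub>R w c))) = a * \<eta> (v(i := u)) + b * \<eta> (v(i := w))) \<and>
        (\<forall>i<k. \<forall>j<k. i \<noteq> j \<and> v i = v j \<longrightarrow> \<eta> v = 0))"

text \<open>The expression of a form in the chart \<open>c\<close>, as a form on an open subset of the model space.\<close>

definition local_form ::
  "('a, 'e::euclidean_space) chart set \<Rightarrow> ('a, 'e) chart \<Rightarrow> ('a, 'e) form \<Rightarrow>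
     'e \<Rightarrow> (nat \<Rightarrow> 'e) \<Rightarrow> real" where
  "local_form A c \<alpha> x e =
     \<alpha> (chart_inv c x) (\<lambda>i. coord_tvec A c (chart_inv c x) (e i))"

definition differential_form ::
  "'a topology \<Rightarrow> ('a, 'e::euclidean_space) chart set \<Rightarrow> nat \<Rightarrow> ('a, 'e) form \<Rightarrow> bool" where
  "differential_form M A k \<alpha> \<longleftrightarrow>
     (\<forall>p\<in>topspace M. alternating_form A k p (\<alpha> p)) \<and>
     (\<forall>c\<in>A. \<forall>e. smooth_on (snd c ` fst c) (\<lambda>x. local_form A c \<alpha> x e))"

text \<open>Equality of \<open>k\<close>-forms: only genuine tangent vectors at points of \<open>M\<close> are tested.\<close>

definition form_eq ::
  "'a topology \<Rightarrow> ('a, 'e::euclidean_space) chart set \<Rightarrow> nat \<Rightarrow>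
     ('a, 'e) form \<Rightarrow> ('a, 'e) form \<Rightarrow> bool" where
  "form_eq M A k \<alpha> \<beta> \<longleftrightarrow>
     (\<forall>p\<in>topspace M. \<forall>v. (\<forall>i<k. v i \<in> tangent_space A p) \<longrightarrow> \<alpha> p v = \<beta> p v)"

text \<open>Exterior derivative of a \<open>k\<close>-form on the model space, evaluated on the \<open>k + 1\<close> constant
  vector fields \<open>e 0, \<dots>, e k\<close>; the index function below omits \<open>e i\<close>.\<close>

definition exterior_derivative ::
  "nat \<Rightarrow> ('e::euclidean_space \<Rightarrow> (nat \<Rightarrow> 'e) \<Rightarrow> real) \<Rightarrow> 'e \<Rightarrow> (nat \<Rightarrow> 'e) \<Rightarrow> real" where
  "exterior_derivative k \<beta> x e =
     (\<Sum>i\<le>k. (-1) ^ i *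
        frechet_derivative (\<lambda>y. \<beta> y (\<lambda>j. e (if j < i then j else Suc j))) (at x) (e i))"

definition closed_form ::
  "('a, 'e::euclidean_space) chart set \<Rightarrow> nat \<Rightarrow> ('a, 'e) form \<Rightarrow> bool" where
  "closed_form A k \<alpha> \<longleftrightarrow>
     (\<forall>c\<in>A. \<forall>x\<in>snd c ` fst c. \<forall>e. exterior_derivative k (local_form A c \<alpha>) x e = 0)"

definition pullback ::
  "('a, 'e::euclidean_space) chart set \<Rightarrow> ('a \<Rightarrow> 'a) \<Rightarrow> ('a, 'e) form \<Rightarrow> ('a, 'e) form" where
  "pullback A f \<alpha> = (\<lambda>p v. \<alpha> (f p) (\<lambda>i. differential A f p (v i)))"

text \<open>Wedge product of a \<open>k\<close>-form and an \<open>l\<close>-form.\<close>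

definition wedge :: "nat \<Rightarrow> nat \<Rightarrow> ('a, 'e) form \<Rightarrow> ('a, 'e) form \<Rightarrow> ('a, 'e) form" where
  "wedge k l \<alpha> \<beta> = (\<lambda>p v.
     (\<Sum>\<sigma> | \<sigma> permutes {..<k + l}.
        of_int (sign \<sigma>) * \<alpha> p (\<lambda>i. v (\<sigma> i)) * \<beta> p (\<lambda>i. v (\<sigma> (k + i))))
     / (fact k * fact l))"

text \<open>The \<open>k\<close>-th exterior power of a \<open>2\<close>-form, which is a form of degree \<open>2 * k\<close>.\<close>

primrec wedge_power :: "('a, 'e) form \<Rightarrow> nat \<Rightarrow> ('a, 'e) form" where
  "wedge_power \<omega> 0 = (\<lambda>p v. 1)"
| "wedge_power \<omega> (Suc k) = wedge 2 (2 * k) \<omega> (wedge_power \<omega> k)"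


section \<open>Symplectic manifolds and groups of diffeomorphisms\<close>

definition nondegenerate ::
  "'a topology \<Rightarrow> ('a, 'e::euclidean_space) chart set \<Rightarrow> ('a, 'e) form \<Rightarrow> bool" where
  "nondegenerate M A \<omega> \<longleftrightarrow>
     (\<forall>p\<in>topspace M. \<forall>u\<in>tangent_space A p.
        (\<forall>w\<in>tangent_space A p. \<omega> p (\<lambda>i. if i = 0 then u else w) = 0) \<longrightarrow> u = (\<lambda>c. 0))"

definition symplectic_manifold ::
  "'a topology \<Rightarrow> ('a, 'e::euclidean_space) chart set \<Rightarrow> ('a, 'e) form \<Rightarrow> bool" where
  "symplectic_manifold M A \<omega> \<longleftrightarrow>
     smooth_manifold M A \<and> differential_form M A 2 \<omega> \<and> closed_form A 2 \<omega> \<and>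
     nondegenerate M A \<omega>"

text \<open>Self-maps of \<open>M\<close> are made extensional, so that equality of functions is equality of maps
  on \<open>M\<close>.\<close>

definition diffeomorphism ::
  "'a topology \<Rightarrow> ('a, 'e::euclidean_space) chart set \<Rightarrow> ('a \<Rightarrow> 'a) \<Rightarrow> bool" where
  "diffeomorphism M A f \<longleftrightarrow>
     f \<in> extensional (topspace M) \<and> bij_betw f (topspace M) (topspace M) \<and>
     smooth_map M A f \<and> smooth_map M A (inv_into (topspace M) f)"

text \<open>\<open>Diff M A k \<alpha>\<close> is the set of diffeomorphisms preserving the \<open>k\<close>-form \<open>\<alpha>\<close>, and
  \<open>Diff0 M A k \<alpha>\<close> is its identity component, in the sense of smooth isotopies.\<close>

definition Diff ::
  "'a topology \<Rightarrow> ('a, 'e::euclidean_space) chart set \<Rightarrow> nat \<Rightarrow> ('a, 'e) form \<Rightarrow>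
     ('a \<Rightarrow> 'a) set" where
  "Diff M A k \<alpha> = {f. diffeomorphism M A f \<and> form_eq M A k (pullback A f \<alpha>) \<alpha>}"

definition Diff0 ::
  "'a topology \<Rightarrow> ('a, 'e::euclidean_space) chart set \<Rightarrow> nat \<Rightarrow> ('a, 'e) form \<Rightarrow>
     ('a \<Rightarrow> 'a) set" where
  "Diff0 M A k \<alpha> =
     {f \<in> Diff M A k \<alpha>.
        \<exists>F. smooth_family M A F \<and> (\<forall>t\<in>{0..1}. F t \<in> Diff M A k \<alpha>) \<and>
            F 0 = restrict id (topspace M) \<and> F 1 = f}"

definition Symp ::
  "'a topology \<Rightarrow> ('a, 'e::euclidean_space) chart set \<Rightarrow> ('a, 'e) form \<Rightarrow> ('a \<Rightarrow> 'a) set" where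
  "Symp M A \<omega> = Diff M A 2 \<omega>"

definition Symp0 ::
  "'a topology \<Rightarrow> ('a, 'e::euclidean_space) chart set \<Rightarrow> ('a, 'e) form \<Rightarrow> ('a \<Rightarrow> 'a) set" where
  "Symp0 M A \<omega> = Diff0 M A 2 \<omega>"

end

theory Submission
  imports Defs
begin

text \<open>An isotopy \<open>f\<^sub>t\<close> starting at the identity and preserving \<open>\<omega>\<^sup>k\<close> already preserves \<open>\<omega>\<close>, for the
following two reasons.

The first is linear algebra at a single point \<open>p\<close>.  Let \<open>\<alpha> = \<omega>\<^sub>p\<close> and \<open>\<beta> = (f\<^sub>t\<^sup>* \<omega>)\<^sub>p\<close>, two alternating
bilinear forms on a space of dimension \<open>2n\<close> with \<open>\<alpha>\<^sup>k = \<beta>\<^sup>k\<close> and \<open>\<alpha>\<close> nondegenerate.  Suppose that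
\<open>\<beta>(u, w) = 0\<close> but \<open>\<alpha>(u, w) = 1\<close>.  On the subspace \<open>S = ker \<beta>(u, -)\<close> the form \<open>\<alpha>\<close> has rank at least
\<open>2n - 2 \<ge> 2k\<close>; this is where \<open>k < n\<close> enters.  So \<open>S\<close> contains a symplectic family of \<open>k\<close> pairs for \<open>\<alpha>\<close> whose
first pair is \<open>(u, w)\<close>.  On this family \<open>\<alpha>\<^sup>k\<close> is positive, whereas \<open>\<beta>\<^sup>k\<close> vanishes because \<open>u\<close> is
\<open>\<beta>\<close>-orthogonal to all its members, a contradiction (\<open>kernel_subset_if_gram_power_eq\<close>).  Hence every zero
of \<open>\<beta>\<close> is a zero of \<open>\<alpha>\<close>, which forces \<open>\<alpha> = c \<beta>\<close> for a constant \<open>c\<close> with \<open>c\<^sup>k = 1\<close>, that is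
\<open>\<alpha> = \<plusminus>\<beta>\<close> (\<open>plus_minus_if_gram_power_eq\<close>).

The second is continuity: for fixed tangent vectors \<open>u, w\<close> at \<open>p\<close> the number \<open>(f\<^sub>t\<^sup>* \<omega>)(u, w)\<close> depends
continuously on \<open>t\<close> (\<open>pullback_continuous_in_time\<close>), has constant absolute value by the first
part, and is \<open>\<omega>(u, w)\<close> at \<open>t = 0\<close>.  So it is constant.

The other inclusion holds because the value of \<open>\<omega>\<^sup>k\<close> on vectors \<open>v\<^sub>0, v\<^sub>1, \<dots>\<close> is a polynomial in the
numbers \<open>\<omega>(v\<^sub>i, v\<^sub>j)\<close>.  This polynomial, \<open>gram_power\<close>, is also what reduces the pointwise statement to a
statement about matrices.\<close>


section \<open>Powers of a two-form as polynomials in the Gram matrix\<close>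

text \<open>For the matrix \<open>a\<^sub>i\<^sub>j = \<omega>(v\<^sub>i, v\<^sub>j)\<close> this is \<open>\<omega>\<^sup>k(v\<^sub>0, \<dots>, v\<^sub>2\<^sub>k\<^sub>-\<^sub>1)\<close>, that is \<open>k!\<close> times the Pfaffian of \<open>a\<close>.  The
recursion copies that of the iterated wedge product, so that the two agree by induction.\<close>

primrec gram_power :: "nat \<Rightarrow> (nat \<Rightarrow> nat \<Rightarrow> real) \<Rightarrow> real" where
  "gram_power 0 a = 1"
| "gram_power (Suc k) a =
     (\<Sum>\<sigma> | \<sigma> permutes {..<2 + 2 * k}.
        of_int (sign \<sigma>) * a (\<sigma> 0) (\<sigma> 1) * gram_power k (\<lambda>i j. a (\<sigma> (2 + i)) (\<sigma> (2 + j))))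
     / (fact 2 * fact (2 * k))"

lemma gram_power_cong:
  assumes "\<And>i j. i < 2 * k \<Longrightarrow> j < 2 * k \<Longrightarrow> a i j = b i j"
  shows "gram_power k a = gram_power k b"
  using assms
proof (induction k arbitrary: a b)
  case (Suc k)
  have "of_int (sign \<sigma>) * a (\<sigma> 0) (\<sigma> 1) * gram_power k (\<lambda>i j. a (\<sigma> (2 + i)) (\<sigma> (2 + j))) =
        of_int (sign \<sigma>) * b (\<sigma> 0) (\<sigma> 1) * gram_power k (\<lambda>i j. b (\<sigma> (2 + i)) (\<sigma> (2 + j)))"
    if "\<sigma> \<in> {\<sigma>. \<sigma> permutes {..<2 + 2 * k}}" for \<sigma>
  proof -
    have \<sigma>: "\<sigma> i < 2 * Suc k" if "i < 2 * Suc k" for i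
      using permutes_in_image[of \<sigma> "{..<2 + 2 * k}" i] \<open>\<sigma> \<in> _\<close> that by simp
    have "gram_power k (\<lambda>i j. a (\<sigma> (2 + i)) (\<sigma> (2 + j))) = gram_power k (\<lambda>i j. b (\<sigma> (2 + i)) (\<sigma> (2 + j)))"
      by (intro Suc.IH Suc.prems \<sigma>) auto
    moreover have "a (\<sigma> 0) (\<sigma> 1) = b (\<sigma> 0) (\<sigma> 1)"
      by (intro Suc.prems \<sigma>) auto
    ultimately show ?thesis by simp
  qed
  then have "(\<Sum>\<sigma> | \<sigma> permutes {..<2 + 2 * k}.
        of_int (sign \<sigma>) * a (\<sigma> 0) (\<sigma> 1) * gram_power k (\<lambda>i j. a (\<sigma> (2 + i)) (\<sigma> (2 + j)))) =
      (\<Sum>\<sigma> | \<sigma> permutes {..<2 + 2 * k}.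
        of_int (sign \<sigma>) * b (\<sigma> 0) (\<sigma> 1) * gram_power k (\<lambda>i j. b (\<sigma> (2 + i)) (\<sigma> (2 + j))))"
    by (rule sum.cong[OF refl])
  then show ?case
    by (simp only: gram_power.simps)
qed simp

text \<open>Composition with \<open>\<tau>\<close> is a bijection of the permutations summed over, and it multiplies each sign
by that of \<open>\<tau>\<close>.\<close>

lemma gram_power_permute:
  assumes "\<tau> permutes {..<2 * k}"
  shows "gram_power k (\<lambda>i j. a (\<tau> i) (\<tau> j)) = of_int (sign \<tau>) * gram_power k a"
proof (cases k)
  case 0
  with assms show ?thesis by simp
next
  case (Suc m)
  let ?P = "{\<sigma>. \<sigma> permutes {..<2 + 2 * m}}"
  define g where
    "g \<sigma> = of_int (sign \<sigma>) * a (\<sigma> 0) (\<sigma> 1) * gram_power m (\<lambda>i j. a (\<sigma> (2 + i)) (\<sigma> (2 + j)))" for \<sigma>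
  have \<tau>: "\<tau> permutes {..<2 + 2 * m}"
    using assms Suc by simp
  have "of_int (sign \<sigma>) * a (\<tau> (\<sigma> 0)) (\<tau> (\<sigma> 1)) *
          gram_power m (\<lambda>i j. a (\<tau> (\<sigma> (2 + i))) (\<tau> (\<sigma> (2 + j)))) =
        of_int (sign \<tau>) * g (\<tau> \<circ> \<sigma>)" if "\<sigma> \<in> ?P" for \<sigma>
  proof -
    have "sign (\<tau> \<circ> \<sigma>) = sign \<tau> * sign \<sigma>"
      using \<tau> that by (intro sign_compose) (auto intro: permutation_permutes[THEN iffD2])
    then have "of_int (sign \<sigma>) = of_int (sign \<tau>) * (of_int (sign (\<tau> \<circ> \<sigma>)) :: real)"
      by (simp add: mult.assoc[symmetric] sign_idempotent of_int_mult[symmetric] del: of_int_mult)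
    then show ?thesis
      by (simp add: g_def mult.assoc)
  qed
  then have "(\<Sum>\<sigma>\<in>?P. of_int (sign \<sigma>) * a (\<tau> (\<sigma> 0)) (\<tau> (\<sigma> 1)) *
          gram_power m (\<lambda>i j. a (\<tau> (\<sigma> (2 + i))) (\<tau> (\<sigma> (2 + j))))) =
        of_int (sign \<tau>) * (\<Sum>\<sigma>\<in>?P. g (\<tau> \<circ> \<sigma>))"
    by (simp add: sum_distrib_left)
  also have "(\<Sum>\<sigma>\<in>?P. g (\<tau> \<circ> \<sigma>)) = sum g ?P"
    using setum_permutations_compose_left[OF \<tau>, of g] by simp
  finally show ?thesis
    by (simp add: Suc g_def)
qed

lemma gram_power_scale:
  "gram_power k (\<lambda>i j. c * a i j) = c ^ k * gram_power k a"
proof (induction k arbitrary: a)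
  case (Suc k)
  show ?case
    by (simp add: Suc sum_distrib_left algebra_simps)
qed simp

text \<open>Every summand of the recursion uses the index \<open>r\<close>: either in the factor \<open>a (\<sigma> 0) (\<sigma> 1)\<close>, or in the
remaining minor, which then has a zero row of its own.\<close>

lemma gram_power_zero_row:
  assumes "r < 2 * k" and "\<And>j. j < 2 * k \<Longrightarrow> a r j = 0" and "\<And>j. j < 2 * k \<Longrightarrow> a j r = 0"
  shows "gram_power k a = 0"
  using assms
proof (induction k arbitrary: a r)
  case (Suc k)
  have "a (\<sigma> 0) (\<sigma> 1) * gram_power k (\<lambda>i j. a (\<sigma> (2 + i)) (\<sigma> (2 + j))) = 0"
    if perm: "\<sigma> permutes {..<2 + 2 * k}" for \<sigma>
  proof -
    have \<sigma>: "\<sigma> i < 2 * Suc k" if "i < 2 * Suc k" for i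
      using permutes_in_image[OF perm, of i] that by simp
    obtain s where s: "\<sigma> s = r"
      using permutes_surj[OF perm] by (metis surj_def)
    with Suc.prems(1) have "s < 2 * Suc k"
      using permutes_in_image[OF perm, of s] by simp
    then consider "s = 0" | "s = 1" | s' where "s = 2 + s'" "s' < 2 * k"
      by (cases s rule: nat.exhaust; cases "s - 1") auto
    then show ?thesis
    proof cases
      case 1
      then show ?thesis using s Suc.prems(2) \<sigma>[of 1] by simp
    next
      case 2
      then show ?thesis using s Suc.prems(3) \<sigma>[of 0] by simp
    next
      case (3 s')
      then have "gram_power k (\<lambda>i j. a (\<sigma> (2 + i)) (\<sigma> (2 + j))) = 0"
        using s Suc.prems(2,3) \<sigma>[of "2 + _"] by (intro Suc.IH[of s']) auto
      then show ?thesis by simp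
    qed
  qed
  then have "(\<Sum>\<sigma> | \<sigma> permutes {..<2 + 2 * k}.
      of_int (sign \<sigma>) * (a (\<sigma> 0) (\<sigma> 1) * gram_power k (\<lambda>i j. a (\<sigma> (2 + i)) (\<sigma> (2 + j))))) = 0"
    by (intro sum.neutral) simp
  then show ?case
    by (simp add: mult.assoc)
qed simp

text \<open>The Gram matrix of a symplectic basis \<open>e\<^sub>1, f\<^sub>1, e\<^sub>2, f\<^sub>2, \<dots>\<close>.\<close>

definition standard_gram :: "nat \<Rightarrow> nat \<Rightarrow> real" where
  "standard_gram i j =
     (if even i \<and> j = Suc i then 1 else if even j \<and> i = Suc j then - 1 else 0)"

lemma standard_gram_shift [simp]:
  "standard_gram (Suc (Suc i)) (Suc (Suc j)) = standard_gram i j"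
  by (simp add: standard_gram_def)

text \<open>Exchanging the first symplectic pair with the pair at positions \<open>x, x + 1\<close> is a symmetry of the
standard matrix.\<close>

lemma standard_gram_swap_pairs:
  assumes "even x" and "x \<ge> 2"
  defines "r \<equiv> \<lambda>i. Transposition.transpose 0 x (Transposition.transpose 1 (Suc x) i)"
  shows "standard_gram (r i) (r j) = standard_gram i j"
proof -
  have r: "r i = (if i = 0 then x else if i = 1 then Suc x else if i = x then 0
      else if i = Suc x then 1 else i)" for i
    using assms(1,2) by (auto simp: r_def Transposition.transpose_def)
  show ?thesis
    using assms(1,2)
    by (cases "i = 0"; cases "i = 1"; cases "i = x"; cases "i = Suc x"; simp add: standard_gram_def r)
       (auto split: if_splits)
qed

text \<open>The analogue of \<open>gram_power_permute\<close> for permutations that fix \<open>0\<close> and \<open>1\<close>, as they arise from the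
recursion; transpositions of the shifted index set are shifted transpositions.\<close>

lemma gram_power_permute_shifted:
  assumes "\<sigma> permutes {2..<2 + 2 * k}"
  shows "gram_power k (\<lambda>i j. a (\<sigma> (2 + i)) (\<sigma> (2 + j))) =
    of_int (sign \<sigma>) * gram_power k (\<lambda>i j. a (2 + i) (2 + j))"
proof -
  have "finite {2..<2 + 2 * k}" by simp
  then show ?thesis
    using assms
  proof (induction arbitrary: a rule: permutes_rev_induct)
    case id
    then show ?case by simp
  next
    case (swap x y p)
    let ?t = "Transposition.transpose (x - 2) (y - 2)"
    have t: "Transposition.transpose x y (2 + i) = 2 + ?t i" for i
      using swap.hyps by (auto simp: Transposition.transpose_def)
    have "?t permutes {..<2 * k}"
      using swap.hyps by (intro permutes_swap_id) auto
    from gram_power_permute[OF this, of "\<lambda>i j. a (p (2 + i)) (p (2 + j))"]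
    have "gram_power k (\<lambda>i j. a (p (2 + ?t i)) (p (2 + ?t j))) = of_int (sign ?t) * (of_int (sign p) *
        gram_power k (\<lambda>i j. a (2 + i) (2 + j)))"
      by (simp only: swap.IH)
    moreover have "sign (p \<circ> Transposition.transpose x y) = sign p * sign ?t"
      using swap.hyps by (subst sign_compose) (auto simp: sign_swap_id permutation_swap_id
          intro: permutation_permutes[THEN iffD2])
    ultimately show ?case
      unfolding o_apply[of p] t by (simp only: of_int_mult mult_ac)
  qed
qed

text \<open>All summands of the recursion that do not vanish are equal.  Such a \<open>\<sigma>\<close> maps \<open>{0, 1}\<close> to one of the
symplectic pairs; after an exchange of pairs, which is an even permutation, and possibly of \<open>0\<close> with
\<open>1\<close>, which changes two signs, it fixes \<open>0\<close> and \<open>1\<close>.  For such permutations the sign cancels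
against the one coming from the minor.\<close>

lemma gram_power_standard_pos: "gram_power k standard_gram > 0"
proof (induction k)
  case (Suc k)
  let ?P = "{\<sigma>. \<sigma> permutes {..<2 + 2 * k}}"
  define g where "g \<sigma> = of_int (sign \<sigma>) * standard_gram (\<sigma> 0) (\<sigma> 1) *
      gram_power k (\<lambda>i j. standard_gram (\<sigma> (2 + i)) (\<sigma> (2 + j)))" for \<sigma>
  have fix01: "g \<sigma> = gram_power k standard_gram"
    if \<sigma>: "\<sigma> permutes {..<2 + 2 * k}" "\<sigma> 0 = 0" "\<sigma> 1 = 1" for \<sigma>
  proof -
    have "\<sigma> permutes {2..<2 + 2 * k}"
      using \<sigma> by (intro permutes_superset[OF \<sigma>(1)]) (auto simp: not_le less_2_cases_iff)
    from gram_power_permute_shifted[OF this, of standard_gram]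
    have "gram_power k (\<lambda>i j. standard_gram (\<sigma> (2 + i)) (\<sigma> (2 + j))) =
        of_int (sign \<sigma>) * gram_power k standard_gram"
      by simp
    moreover have "standard_gram (\<sigma> 0) (\<sigma> 1) = 1"
      by (simp only: \<sigma>) (simp add: standard_gram_def)
    moreover have "of_int (sign \<sigma>) * of_int (sign \<sigma>) = (1::real)"
      by (simp flip: of_int_mult)
    ultimately show ?thesis
      by (simp only: g_def) (simp add: mult.assoc[symmetric])
  qed
  have pos_pair: "g \<sigma> = gram_power k standard_gram"
    if \<sigma>: "\<sigma> permutes {..<2 + 2 * k}" and m: "even (\<sigma> 0)" "\<sigma> 1 = Suc (\<sigma> 0)" for \<sigma>
  proof (cases "\<sigma> 0 = 0")
    case True
    with m \<sigma> show ?thesis by (intro fix01) auto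
  next
    case False
    let ?x = "\<sigma> 0"
    let ?r = "Transposition.transpose 0 ?x \<circ> Transposition.transpose 1 (Suc ?x)"
    have lt: "?x < 2 + 2 * k" "Suc ?x < 2 + 2 * k"
      using permutes_in_image[OF \<sigma>, of 0] permutes_in_image[OF \<sigma>, of 1] m by simp_all
    have x: "?x \<ge> 2"
      using False m(1) by presburger
    have r: "?r permutes {..<2 + 2 * k}"
      using lt by (intro permutes_compose permutes_swap_id) auto
    have sr: "sign ?r = 1"
      using x by (subst sign_compose) (auto simp: sign_swap_id permutation_swap_id)
    have inv: "standard_gram (?r i) (?r j) = standard_gram i j" for i j
      using standard_gram_swap_pairs[OF m(1) x] by simp
    have "g (?r \<circ> \<sigma>) = g \<sigma>"
    proof -
      have "sign (?r \<circ> \<sigma>) = sign \<sigma>"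
        using sr sign_compose[of ?r \<sigma>] r \<sigma> permutation_permutes by force
      then show ?thesis
        unfolding g_def o_apply[of ?r \<sigma>] inv by (rule arg_cong)
    qed
    moreover have "g (?r \<circ> \<sigma>) = gram_power k standard_gram"
      using m x by (intro fix01 permutes_compose r \<sigma>) (auto simp: Transposition.transpose_def)
    ultimately show ?thesis by simp
  qed
  have neg_pair: "g \<sigma> = gram_power k standard_gram"
    if \<sigma>: "\<sigma> permutes {..<2 + 2 * k}" and m: "even (\<sigma> 1)" "\<sigma> 0 = Suc (\<sigma> 1)" for \<sigma>
  proof -
    let ?s = "Transposition.transpose 0 (1::nat)"
    have s: "?s permutes {..<2 + 2 * k}"
      by (intro permutes_swap_id) auto
    have "sign (\<sigma> \<circ> ?s) = - sign \<sigma>"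
      using \<sigma> by (subst sign_compose) (auto simp: sign_swap_id permutation_swap_id
          intro: permutation_permutes[THEN iffD2])
    moreover have "standard_gram (\<sigma> 1) (\<sigma> 0) = - standard_gram (\<sigma> 0) (\<sigma> 1)"
      using m by (simp add: standard_gram_def)
    moreover have "?s (2 + i) = 2 + i" for i
      by (simp add: Transposition.transpose_def)
    ultimately have "g (\<sigma> \<circ> ?s) = g \<sigma>"
      by (simp add: g_def)
    moreover have "g (\<sigma> \<circ> ?s) = gram_power k standard_gram"
      using m by (intro pos_pair permutes_compose s \<sigma>) auto
    ultimately show ?thesis by simp
  qed
  have "g \<sigma> \<ge> 0" if "\<sigma> \<in> ?P" for \<sigma>
  proof (cases "standard_gram (\<sigma> 0) (\<sigma> 1) = 0")
    case True
    then show ?thesis by (simp add: g_def)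
  next
    case False
    then have "even (\<sigma> 0) \<and> \<sigma> 1 = Suc (\<sigma> 0) \<or> even (\<sigma> 1) \<and> \<sigma> 0 = Suc (\<sigma> 1)"
      by (auto simp: standard_gram_def split: if_splits)
    with that have "g \<sigma> = gram_power k standard_gram"
      using pos_pair neg_pair by blast
    with Suc show ?thesis by simp
  qed
  moreover have "g id > 0"
    using fix01[of id] Suc by (simp add: permutes_id)
  ultimately have "sum g ?P > 0"
    by (intro sum_pos2[of _ id]) (auto simp: finite_permutations permutes_id)
  then show ?case
    by (simp add: g_def)
qed simp

section \<open>Symplectic families in spaces with an alternating form\<close>

definition alternating_bilinear :: "('e::real_vector \<Rightarrow> 'e \<Rightarrow> real) \<Rightarrow> bool" where
  "alternating_bilinear \<alpha> \<longleftrightarrow> 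
     (\<forall>x. linear (\<alpha> x)) \<and> (\<forall>y. linear (\<lambda>x. \<alpha> x y)) \<and> (\<forall>x. \<alpha> x x = 0)"

definition form_radical :: "('e \<Rightarrow> 'e \<Rightarrow> real) \<Rightarrow> 'e set \<Rightarrow> 'e set" where
  "form_radical \<alpha> S = {x \<in> S. \<forall>y\<in>S. \<alpha> x y = 0}"

lemma alternating_bilinear_rules:
  assumes "alternating_bilinear \<alpha>"
  shows "\<alpha> x (y + z) = \<alpha> x y + \<alpha> x z" "\<alpha> (x + y) z = \<alpha> x z + \<alpha> y z"
    "\<alpha> x (y - z) = \<alpha> x y - \<alpha> x z" "\<alpha> (x - y) z = \<alpha> x z - \<alpha> y z"
    "\<alpha> x (c *\<^sub>R y) = c * \<alpha> x y" "\<alpha> (c *\<^sub>R x) y = c * \<alpha> x y"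
    "\<alpha> x 0 = 0" "\<alpha> 0 x = 0" "\<alpha> x x = 0"
proof -
  have l: "linear (\<alpha> x)" and r: "linear (\<lambda>x. \<alpha> x y)" for x y
    using assms by (auto simp: alternating_bilinear_def)
  show "\<alpha> x (y + z) = \<alpha> x y + \<alpha> x z" "\<alpha> x (y - z) = \<alpha> x y - \<alpha> x z"
    "\<alpha> x (c *\<^sub>R y) = c * \<alpha> x y" "\<alpha> x 0 = 0"
    using l[of x] by (simp_all add: linear_add linear_diff linear_scale linear_0)
  show "\<alpha> (x + y) z = \<alpha> x z + \<alpha> y z" "\<alpha> (x - y) z = \<alpha> x z - \<alpha> y z"
    using linear_add[OF r[of z]] linear_diff[OF r[of z]] by auto
  show "\<alpha> (c *\<^sub>R x) y = c * \<alpha> x y" "\<alpha> 0 x = 0" 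
    using linear_scale[OF r[of y]] linear_0[OF r[of x]] by auto
  show "\<alpha> x x = 0"
    using assms by (auto simp: alternating_bilinear_def)
qed

lemma alternating_bilinear_swap:
  assumes "alternating_bilinear \<alpha>"
  shows "\<alpha> x y = - \<alpha> y x"
  using alternating_bilinear_rules(2)[OF assms, of x y "x + y"]
    alternating_bilinear_rules(1)[OF assms, of x x y] alternating_bilinear_rules(1)[OF assms, of y x y]
    alternating_bilinear_rules(9)[OF assms, of x] alternating_bilinear_rules(9)[OF assms, of y]
    alternating_bilinear_rules(9)[OF assms, of "x + y"]
  by linarith

lemma alternating_bilinear_expand:
  fixes B :: "'e::euclidean_space \<Rightarrow> 'e \<Rightarrow> real"
  assumes "alternating_bilinear B"
  shows "B x y = (\<Sum>i\<in>Basis. \<Sum>j\<in>Basis. (x \<bullet> i) * (y \<bullet> j) * B i j)"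
proof -
  have r: "linear (B i)" and l: "linear (\<lambda>x. B x y)" for i y
    using assms by (auto simp: alternating_bilinear_def)
  have left: "B x y = (\<Sum>i\<in>Basis. (x \<bullet> i) * B i y)"
    by (subst (1) euclidean_representation[of x, symmetric])
       (simp add: linear_sum[OF l] linear_scale[OF l])
  have right: "B i y = (\<Sum>j\<in>Basis. (y \<bullet> j) * B i j)" for i
    by (subst (1) euclidean_representation[of y, symmetric])
       (simp add: linear_sum[OF r] linear_scale[OF r])
  show ?thesis
    unfolding left by (simp only: right[of _] sum_distrib_left mult.assoc)
qed

text \<open>One step of the symplectic Gram-Schmidt process.  Splitting a hyperbolic pair off \<open>S\<close> leaves the
radical inside the old one, since \<open>S\<close> is spanned by the pair and its complement \<open>S'\<close>.\<close>

lemma orthogonal_complement_of_pair: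
  fixes \<alpha> :: "'e::euclidean_space \<Rightarrow> 'e \<Rightarrow> real"
  assumes \<alpha>: "alternating_bilinear \<alpha>" and S: "subspace S" and ef: "e \<in> S" "f \<in> S" "\<alpha> e f = 1"
  defines "S' \<equiv> {y \<in> S. \<alpha> e y = 0 \<and> \<alpha> f y = 0}"
  shows "subspace S'" and "dim S \<le> dim S' + 2" and "form_radical \<alpha> S' \<subseteq> form_radical \<alpha> S"
proof -
  note rules = alternating_bilinear_rules[OF \<alpha>]
  have fe: "\<alpha> f e = - 1"
    using ef(3) alternating_bilinear_swap[OF \<alpha>, of f e] by simp
  show "subspace S'"
    using S by (auto simp: S'_def subspace_def rules)
  have split: "y - \<alpha> e y *\<^sub>R f + \<alpha> f y *\<^sub>R e \<in> S'" if "y \<in> S" for y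
    using that S ef fe
    by (auto simp: S'_def rules intro!: subspace_add subspace_diff subspace_scale)
  have "S \<subseteq> span (insert e (insert f S'))"
  proof
    fix y assume "y \<in> S"
    have "y = (y - \<alpha> e y *\<^sub>R f + \<alpha> f y *\<^sub>R e) + \<alpha> e y *\<^sub>R f - \<alpha> f y *\<^sub>R e"
      by simp
    also have "\<dots> \<in> span (insert e (insert f S'))"
      using split[OF \<open>y \<in> S\<close>]
      by (intro span_diff[OF span_add[OF span_base span_scale[OF span_base]] span_scale[OF span_base]]) auto
    finally show "y \<in> span (insert e (insert f S'))" .
  qed
  then have "dim S \<le> dim (insert e (insert f S'))"
    by (rule dim_mono)
  also have "\<dots> \<le> dim S' + 2"
    by (simp add: dim_insert)
  finally show "dim S \<le> dim S' + 2" .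
  show "form_radical \<alpha> S' \<subseteq> form_radical \<alpha> S"
  proof
    fix x assume x: "x \<in> form_radical \<alpha> S'"
    then have "\<alpha> x e = 0" "\<alpha> x f = 0"
      using alternating_bilinear_swap[OF \<alpha>, of x e] alternating_bilinear_swap[OF \<alpha>, of x f]
      by (auto simp: form_radical_def S'_def)
    moreover have "\<alpha> x (y - \<alpha> e y *\<^sub>R f + \<alpha> f y *\<^sub>R e) = 0" if "y \<in> S" for y
      using x split[OF that] by (simp add: form_radical_def)
    ultimately show "x \<in> form_radical \<alpha> S"
      using x by (simp add: form_radical_def S'_def rules)
  qed
qed

lemma standard_family_prepend:
  fixes \<alpha> :: "'e::euclidean_space \<Rightarrow> 'e \<Rightarrow> real"
  assumes \<alpha>: "alternating_bilinear \<alpha>" and ef: "e \<in> S" "f \<in> S" "\<alpha> e f = 1"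
    and x: "\<And>i. i < 2 * k \<Longrightarrow> x i \<in> S \<and> \<alpha> e (x i) = 0 \<and> \<alpha> f (x i) = 0"
    and gram: "\<And>i j. i < 2 * k \<Longrightarrow> j < 2 * k \<Longrightarrow> \<alpha> (x i) (x j) = standard_gram i j"
  defines "z \<equiv> (\<lambda>i. if i = 0 then e else if i = 1 then f else x (i - 2))"
  assumes ij: "i < 2 * Suc k" "j < 2 * Suc k"
  shows "z i \<in> S" and "\<alpha> (z i) (z j) = standard_gram i j"
proof -
  have z: "z 0 = e" "z (Suc 0) = f" "z (Suc (Suc l)) = x l" for l
    by (simp_all add: z_def)
  have index: "i = 0 \<or> i = Suc 0 \<or> (\<exists>l<2 * k. i = Suc (Suc l))" if "i < 2 * Suc k" for i
    using that by (cases i rule: nat.exhaust; cases "i - 1") auto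
  have x': "\<alpha> (x l) e = 0" "\<alpha> (x l) f = 0" if "l < 2 * k" for l
    using x[OF that] alternating_bilinear_swap[OF \<alpha>, of "x l" e]
      alternating_bilinear_swap[OF \<alpha>, of "x l" f] by simp_all
  have fe: "\<alpha> f e = - 1"
    using ef(3) alternating_bilinear_swap[OF \<alpha>, of f e] by simp
  show "z i \<in> S"
    using index[OF ij(1)] ef x by (auto simp: z)
  show "\<alpha> (z i) (z j) = standard_gram i j"
    using index[OF ij(1)] index[OF ij(2)] ef(3) fe x x' gram alternating_bilinear_rules(9)[OF \<alpha>]
    by (elim disjE exE conjE) (simp_all add: z, simp_all add: standard_gram_def)
qed

text \<open>The difference \<open>dim S - dim (form_radical \<alpha> S)\<close> is the rank of \<open>\<alpha>\<close> on \<open>S\<close>, and each split-off pair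
lowers it by at most two.\<close>

lemma exists_standard_family:
  fixes \<alpha> :: "'e::euclidean_space \<Rightarrow> 'e \<Rightarrow> real"
  assumes "alternating_bilinear \<alpha>" and "subspace S" and "dim (form_radical \<alpha> S) + 2 * k \<le> dim S"
  shows "\<exists>x. (\<forall>i<2 * k. x i \<in> S) \<and>
    (\<forall>i<2 * k. \<forall>j<2 * k. \<alpha> (x i) (x j) = standard_gram i j)"
  using assms(2,3)
proof (induction k arbitrary: S)
  case (Suc k)
  note rules = alternating_bilinear_rules[OF assms(1)]
  have "\<not> S \<subseteq> form_radical \<alpha> S"
    using Suc.prems(2) dim_subset[of S "form_radical \<alpha> S"] by auto
  then obtain e y where ey: "e \<in> S" "y \<in> S" "\<alpha> e y \<noteq> 0"
    by (auto simp: form_radical_def)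
  define f where "f = (1 / \<alpha> e y) *\<^sub>R y"
  have f: "f \<in> S" "\<alpha> e f = 1"
    using ey Suc.prems(1) by (auto simp: f_def rules subspace_scale)
  define S' where "S' = {y \<in> S. \<alpha> e y = 0 \<and> \<alpha> f y = 0}"
  note S' = orthogonal_complement_of_pair[OF assms(1) Suc.prems(1) ey(1) f, folded S'_def]
  have "dim (form_radical \<alpha> S') + 2 * k \<le> dim S'"
    using S'(2) dim_subset[OF S'(3)] Suc.prems(2) by simp
  from Suc.IH[OF S'(1) this] obtain x where
    x: "\<And>i. i < 2 * k \<Longrightarrow> x i \<in> S'"
      "\<And>i j. i < 2 * k \<Longrightarrow> j < 2 * k \<Longrightarrow> \<alpha> (x i) (x j) = standard_gram i j"
    by auto
  have x': "x i \<in> S \<and> \<alpha> e (x i) = 0 \<and> \<alpha> f (x i) = 0" if "i < 2 * k" for i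
    using x(1)[OF that] by (simp add: S'_def)
  show ?case
    by (intro exI[of _ "\<lambda>i. if i = 0 then e else if i = 1 then f else x (i - 2)"] conjI allI impI)
       (rule standard_family_prepend[OF assms(1) ey(1) f x' x(2)]; assumption)+
qed simp

definition nondegenerate_bilinear :: "('e::real_vector \<Rightarrow> 'e \<Rightarrow> real) \<Rightarrow> bool" where
  "nondegenerate_bilinear \<alpha> \<longleftrightarrow> (\<forall>x. (\<forall>y. \<alpha> x y = 0) \<longrightarrow> x = 0)"

text \<open>On the kernel of a functional a nondegenerate form has rank at least \<open>DIM('e) - 2\<close>: if the kernel is
a hyperplane, then an element of the radical is determined by its pairing with a single vector \<open>z\<close>
outside.\<close>

lemma dim_kernel_and_radical:
  fixes \<alpha> :: "'e::euclidean_space \<Rightarrow> 'e \<Rightarrow> real"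
  assumes \<alpha>: "alternating_bilinear \<alpha>" "nondegenerate_bilinear \<alpha>" and h: "linear (h :: 'e \<Rightarrow> real)"
  shows "dim (form_radical \<alpha> {y. h y = 0}) \<le> 1" and "DIM('e) \<le> dim {y. h y = 0} + 1"
proof -
  note rules = alternating_bilinear_rules[OF \<alpha>(1)]
  let ?S = "{y. h y = 0}"
  have "dim (form_radical \<alpha> ?S) \<le> 1 \<and> DIM('e) \<le> dim ?S + 1"
  proof (cases "?S = UNIV")
    case True
    then have "form_radical \<alpha> ?S \<subseteq> {0}"
      using \<alpha>(2) by (auto simp: form_radical_def nondegenerate_bilinear_def)
    then have "dim (form_radical \<alpha> ?S) = 0"
      by simp
    moreover have "dim ?S = DIM('e)"
      using True by simp
    ultimately show ?thesis
      by linarith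
  next
    case False
    then obtain z where z: "h z \<noteq> 0" by auto
    have split: "y - (h y / h z) *\<^sub>R z \<in> ?S" for y
      using z by (simp add: linear_diff[OF h] linear_scale[OF h])
    have "y \<in> span (insert z ?S)" for y
      using span_add[OF span_base span_scale[OF span_base], of "y - (h y / h z) *\<^sub>R z" "insert z ?S" z "h y / h z"]
        split[of y] by simp
    then have "dim (UNIV :: 'e set) \<le> dim (insert z ?S)"
      by (intro dim_mono) auto
    then have "DIM('e) \<le> dim ?S + 1"
      by (simp add: dim_insert split: if_splits)
    moreover have "dim (form_radical \<alpha> ?S) \<le> 1"
    proof (cases "form_radical \<alpha> ?S \<subseteq> {0}")
      case True
      then have "dim (form_radical \<alpha> ?S) = 0"
        by simp
      then show ?thesis by linarith
    next
      case False
      then obtain y0 where y0: "y0 \<in> form_radical \<alpha> ?S" "y0 \<noteq> 0" by auto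
      have zero: "x = 0" if "\<And>y. y \<in> ?S \<Longrightarrow> \<alpha> x y = 0" "\<alpha> x z = 0" for x
      proof -
        have "\<alpha> x y = 0" for y
          using that(1)[OF split[of y]] that(2) by (simp add: rules)
        then show ?thesis
          using \<alpha>(2) by (auto simp: nondegenerate_bilinear_def)
      qed
      have "\<alpha> y0 z \<noteq> 0"
        using zero[of y0] y0 by (auto simp: form_radical_def)
      have "y \<in> span {y0}" if "y \<in> form_radical \<alpha> ?S" for y
      proof -
        have "y - (\<alpha> y z / \<alpha> y0 z) *\<^sub>R y0 = 0"
          using that y0(1) \<open>\<alpha> y0 z \<noteq> 0\<close> by (intro zero) (auto simp: form_radical_def rules)
        then show ?thesis
          by (metis eq_iff_diff_eq_0 span_base span_scale insertI1)
      qed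
      then have "dim (form_radical \<alpha> ?S) \<le> dim {y0}"
        by (intro dim_mono) auto
      also have "\<dots> \<le> 1"
        by (simp add: dim_insert)
      finally show ?thesis .
    qed
    ultimately show ?thesis by simp
  qed
  then show "dim (form_radical \<alpha> ?S) \<le> 1" "DIM('e) \<le> dim ?S + 1"
    by auto
qed

section \<open>Alternating forms with equal powers\<close>

text \<open>The core of the argument.  Inside \<open>S = ker \<beta>(u, -)\<close>, the pair formed by \<open>u\<close> and a multiple of \<open>w\<close> extends to a
symplectic family for \<open>\<alpha>\<close>; on it \<open>\<alpha>\<^sup>k\<close> does not vanish, but \<open>\<beta>\<^sup>k\<close> does because the row of \<open>u\<close> in the Gram
matrix of \<open>\<beta>\<close> is zero.\<close>

lemma kernel_subset_if_gram_power_eq: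
  fixes \<alpha> \<beta> :: "'e::euclidean_space \<Rightarrow> 'e \<Rightarrow> real"
  assumes \<alpha>: "alternating_bilinear \<alpha>" "nondegenerate_bilinear \<alpha>" and \<beta>: "alternating_bilinear \<beta>"
    and k: "0 < k" "2 * k + 2 \<le> DIM('e)"
    and eq: "\<And>x. gram_power k (\<lambda>i j. \<beta> (x i) (x j)) = gram_power k (\<lambda>i j. \<alpha> (x i) (x j))"
    and uw: "\<beta> u w = 0"
  shows "\<alpha> u w = 0"
proof (rule ccontr)
  assume "\<alpha> u w \<noteq> 0"
  define S where "S = {y. \<beta> u y = 0}"
  have lin: "linear (\<beta> u)"
    using \<beta> by (simp add: alternating_bilinear_def)
  have S: "subspace S"
    unfolding S_def using linear_subspace_kernel[OF lin] .
  define f where "f = (1 / \<alpha> u w) *\<^sub>R w"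
  have uf: "u \<in> S" "f \<in> S" "\<alpha> u f = 1"
    using uw \<open>\<alpha> u w \<noteq> 0\<close>
    by (auto simp: S_def f_def alternating_bilinear_rules[OF \<alpha>(1)] alternating_bilinear_rules[OF \<beta>])
  obtain l where l: "k = Suc l"
    using k(1) by (cases k) auto
  define S' where "S' = {y \<in> S. \<alpha> u y = 0 \<and> \<alpha> f y = 0}"
  note S' = orthogonal_complement_of_pair[OF \<alpha>(1) S uf, folded S'_def]
  note dims = dim_kernel_and_radical[OF \<alpha> lin, folded S_def]
  have "dim (form_radical \<alpha> S') + 2 * l \<le> dim S'"
    using S'(2) dim_subset[OF S'(3)] dims k(2) l by simp
  from exists_standard_family[OF \<alpha>(1) S'(1) this] obtain x where
    x: "\<And>i. i < 2 * l \<Longrightarrow> x i \<in> S'"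
      "\<And>i j. i < 2 * l \<Longrightarrow> j < 2 * l \<Longrightarrow> \<alpha> (x i) (x j) = standard_gram i j"
    by auto
  have x': "x i \<in> S \<and> \<alpha> u (x i) = 0 \<and> \<alpha> f (x i) = 0" if "i < 2 * l" for i
    using x(1)[OF that] by (simp add: S'_def)
  define z where "z = (\<lambda>i. if i = 0 then u else if i = 1 then f else x (i - 2))"
  have z: "z i \<in> S" "\<alpha> (z i) (z j) = standard_gram i j" if "i < 2 * k" "j < 2 * k" for i j
    unfolding z_def
    by (rule standard_family_prepend[OF \<alpha>(1) uf x' x(2)]; use that l in simp)+
  have z0: "z 0 = u"
    by (simp add: z_def)
  have "gram_power k (\<lambda>i j. \<alpha> (z i) (z j)) = gram_power k standard_gram"
    by (intro gram_power_cong) (rule z(2))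
  moreover have "gram_power k (\<lambda>i j. \<beta> (z i) (z j)) = 0"
  proof (rule gram_power_zero_row[of 0])
    show row: "\<beta> (z 0) (z j) = 0" if "j < 2 * k" for j
      using z(1)[OF that that] unfolding S_def by (simp add: z0)
    show "\<beta> (z j) (z 0) = 0" if "j < 2 * k" for j
      using alternating_bilinear_swap[OF \<beta>, of "z j" "z 0"] row[OF that] by linarith
  qed (use k in simp)
  ultimately show False
    using eq[of z] gram_power_standard_pos[of k] by simp
qed

text \<open>For fixed \<open>u\<close> the functional \<open>\<alpha>(u, -)\<close> vanishes on the kernel of \<open>\<beta>(u, -)\<close>, hence is a multiple of
it.  The factors for two vectors \<open>u\<close> and \<open>v\<close> are compared through a vector \<open>y\<close> that is
\<open>\<beta>\<close>-orthogonal to neither, using the symmetry of the roles of the two arguments.\<close>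

lemma proportional_if_kernel_subset:
  fixes \<alpha> \<beta> :: "'e::euclidean_space \<Rightarrow> 'e \<Rightarrow> real"
  assumes \<alpha>: "alternating_bilinear \<alpha>" and \<beta>: "alternating_bilinear \<beta>"
    and ker: "\<And>u w. \<beta> u w = 0 \<Longrightarrow> \<alpha> u w = 0"
  obtains c where "\<And>u w. \<alpha> u w = c * \<beta> u w"
proof -
  note ra = alternating_bilinear_rules[OF \<alpha>] and rb = alternating_bilinear_rules[OF \<beta>]
  define c where "c u w = \<alpha> u w / \<beta> u w" for u w
  have c1: "\<alpha> u v = c u w * \<beta> u v" if "\<beta> u w \<noteq> 0" for u v w
  proof -
    have "\<alpha> u (v - (\<beta> u v / \<beta> u w) *\<^sub>R w) = 0"
      using that by (intro ker) (simp add: rb)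
    then show ?thesis
      by (simp add: ra c_def)
  qed
  have c2: "\<alpha> v w = c u w * \<beta> v w" if "\<beta> u w \<noteq> 0" for u v w
  proof -
    have "\<beta> w u \<noteq> 0"
      using that alternating_bilinear_swap[OF \<beta>, of u w] by simp
    from c1[OF this, of v] show ?thesis
      using alternating_bilinear_swap[OF \<alpha>, of w v] alternating_bilinear_swap[OF \<beta>, of w v]
        alternating_bilinear_swap[OF \<alpha>, of w u] alternating_bilinear_swap[OF \<beta>, of w u]
      by (simp add: c_def)
  qed
  show thesis
  proof (cases "\<exists>u w. \<beta> u w \<noteq> 0")
    case False
    then show thesis using that[of 0] ker by auto
  next
    case True
    then obtain u0 w0 where nz: "\<beta> u0 w0 \<noteq> 0" by auto
    have "\<alpha> v x = c u0 w0 * \<beta> v x" for v x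
    proof (cases "\<beta> v x = 0")
      case True
      then show ?thesis using ker by simp
    next
      case False
      have "c v x = c u0 w0"
      proof -
        \<comment> \<open>a real vector space is not the union of two proper subspaces\<close>
        obtain y where y: "\<beta> u0 y \<noteq> 0" "\<beta> v y \<noteq> 0"
        proof (cases "\<beta> v w0 = 0 \<and> \<beta> u0 x = 0")
          case True
          then show ?thesis
            using nz False by (intro that[of "w0 + x"]) (simp_all add: rb)
        next
          case False
          then show ?thesis
            using nz \<open>\<beta> v x \<noteq> 0\<close> by (auto intro: that)
        qed
        have "c v y = c v x"
          using c1[OF False, of y] y(2) by (simp add: c_def[of v y])
        moreover have "c u0 y = c u0 w0"
          using c1[OF nz, of y] y(1) by (simp add: c_def[of u0 y])
        moreover have "c v y = c u0 y"
          using c2[OF y(1), of v] y(2) by (simp add: c_def[of v y])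
        ultimately have "c v x = c u0 w0" by simp
        then show ?thesis by simp
      qed
      then show ?thesis
        using c1[OF False, of x] by simp
    qed
    then show thesis by (rule that)
  qed
qed

text \<open>The factor of proportionality satisfies \<open>c\<^sup>k = 1\<close> by homogeneity, once \<open>\<alpha>\<^sup>k\<close> is known to be nonzero
somewhere; a symplectic family shows this.\<close>

lemma plus_minus_if_gram_power_eq:
  fixes \<alpha> \<beta> :: "'e::euclidean_space \<Rightarrow> 'e \<Rightarrow> real"
  assumes \<alpha>: "alternating_bilinear \<alpha>" "nondegenerate_bilinear \<alpha>" and \<beta>: "alternating_bilinear \<beta>"
    and k: "0 < k" "2 * k + 2 \<le> DIM('e)"
    and eq: "\<And>x. gram_power k (\<lambda>i j. \<beta> (x i) (x j)) = gram_power k (\<lambda>i j. \<alpha> (x i) (x j))"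
  shows "\<bar>\<beta> u w\<bar> = \<bar>\<alpha> u w\<bar>"
proof -
  have ker: "\<alpha> u w = 0" if "\<beta> u w = 0" for u w
    using kernel_subset_if_gram_power_eq[OF assms that] .
  from proportional_if_kernel_subset[OF \<alpha>(1) \<beta> ker] obtain c
    where c: "\<And>u w. \<alpha> u w = c * \<beta> u w" by blast
  have "form_radical \<alpha> UNIV \<subseteq> {0}"
    using \<alpha>(2) by (auto simp: form_radical_def nondegenerate_bilinear_def)
  then have "dim (form_radical \<alpha> UNIV) = 0"
    by simp
  moreover have "dim (UNIV :: 'e set) = DIM('e)"
    by simp
  ultimately have "dim (form_radical \<alpha> UNIV) + 2 * k \<le> dim (UNIV :: 'e set)"
    using k(2) by linarith
  from exists_standard_family[OF \<alpha>(1) subspace_UNIV this] obtain x where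
    x: "\<And>i j. i < 2 * k \<Longrightarrow> j < 2 * k \<Longrightarrow> \<alpha> (x i) (x j) = standard_gram i j"
    by auto
  have "gram_power k (\<lambda>i j. \<alpha> (x i) (x j)) = gram_power k standard_gram"
    by (intro gram_power_cong x)
  then have pos: "gram_power k (\<lambda>i j. \<alpha> (x i) (x j)) > 0"
    using gram_power_standard_pos[of k] by simp
  have "gram_power k (\<lambda>i j. \<alpha> (x i) (x j)) = c ^ k * gram_power k (\<lambda>i j. \<beta> (x i) (x j))"
    by (simp only: c gram_power_scale)
  also have "\<dots> = c ^ k * gram_power k (\<lambda>i j. \<alpha> (x i) (x j))"
    by (simp only: eq)
  finally have "gram_power k (\<lambda>i j. \<alpha> (x i) (x j)) = c ^ k * gram_power k (\<lambda>i j. \<alpha> (x i) (x j))" .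
  with pos have "c ^ k = 1"
    by simp
  then have "\<bar>c\<bar> ^ k = 1"
    by (simp flip: power_abs)
  then have "\<bar>c\<bar> = 1"
    using k(1) power_eq_imp_eq_base[of "\<bar>c\<bar>" k 1] by simp
  then show ?thesis
    by (simp add: c abs_mult)
qed

section \<open>Charts and tangent spaces\<close>

lemma smooth_on_open_imp:
  assumes "smooth_on S f" and "open S"
  shows "continuous_on S f" and "x \<in> S \<Longrightarrow> f differentiable (at x)"
proof -
  have *: "f differentiable (at x)" if "x \<in> S" for x
  proof -
    obtain T g where T: "open T" "x \<in> T" "\<forall>k. Ck_on k T g" "\<forall>y\<in>S \<inter> T. g y = f y"
      using assms(1) \<open>x \<in> S\<close> unfolding smooth_on_def by blast
    have "Ck_on (Suc 0) T g"
      using T(3) by blast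
    then have "g differentiable (at x)"
      using T(2) by simp
    then show ?thesis
      using T that assms(2) by (auto simp: differentiable_def
          intro: has_derivative_transform_within_open[of g _ x UNIV "S \<inter> T"])
  qed
  then show "x \<in> S \<Longrightarrow> f differentiable (at x)"
    by blast
  show "continuous_on S f"
    using * by (simp add: differentiable_at_withinI differentiable_imp_continuous_on differentiable_on_def)
qed

lemma chart_inv_inverse:
  assumes "is_chart M c"
  shows "p \<in> fst c \<Longrightarrow> chart_inv c (snd c p) = p"
    and "x \<in> snd c ` fst c \<Longrightarrow> snd c (chart_inv c x) = x"
    and "x \<in> snd c ` fst c \<Longrightarrow> chart_inv c x \<in> fst c"
proof -
  have "topspace (subtopology M (fst c)) = fst c"
    using assms openin_subset by (auto simp: is_chart_def)
  then have "inj_on (snd c) (fst c)"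
    using assms homeomorphic_imp_injective_map unfolding is_chart_def by metis
  then show "p \<in> fst c \<Longrightarrow> chart_inv c (snd c p) = p"
    by (simp add: chart_inv_def)
  show "x \<in> snd c ` fst c \<Longrightarrow> snd c (chart_inv c x) = x"
    "x \<in> snd c ` fst c \<Longrightarrow> chart_inv c x \<in> fst c"
    by (simp_all add: chart_inv_def f_inv_into_f inv_into_into)
qed

lemma open_chart_image:
  assumes c: "is_chart M c" and U: "openin M U"
  shows "open (snd c ` (fst c \<inter> U))"
proof -
  have "openin (subtopology M (fst c)) (fst c \<inter> U)"
    using U by (auto simp: openin_subtopology)
  then have "openin (top_of_set (snd c ` fst c)) (snd c ` (fst c \<inter> U))"
    using c homeomorphic_imp_open_map unfolding is_chart_def open_map_def by blast
  then show ?thesis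
    using c openin_open_trans by (auto simp: is_chart_def)
qed

text \<open>The coordinate domains on which \<open>smooth_map\<close> tests smoothness are open, so there smoothness has its
usual meaning.\<close>

lemma open_chart_preimage:
  assumes c: "is_chart M c" and d: "is_chart M d" and f: "continuous_map M M f"
  shows "open {x \<in> snd c ` fst c. f (chart_inv c x) \<in> fst d}"
proof -
  let ?U = "{p \<in> topspace M. f p \<in> fst d}"
  have "openin M ?U"
    using d f by (intro openin_continuous_map_preimage) (auto simp: is_chart_def)
  moreover have "{x \<in> snd c ` fst c. f (chart_inv c x) \<in> fst d} = snd c ` (fst c \<inter> ?U)"
    using c chart_inv_inverse[OF c] openin_subset[of M "fst c"] by (force simp: is_chart_def)
  ultimately show ?thesis
    using open_chart_image[OF c] by simp
qed

lemma smooth_atlas_chart: "smooth_atlas M A \<Longrightarrow> c \<in> charts_at A p \<Longrightarrow> is_chart M c"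
  by (auto simp: smooth_atlas_def charts_at_def)

lemma charts_at_nonempty:
  assumes "smooth_atlas M A" and "p \<in> topspace M"
  shows "(SOME c. c \<in> charts_at A p) \<in> charts_at A p"
proof (rule someI_ex)
  have "p \<in> (\<Union>c\<in>A. fst c)"
    using assms unfolding smooth_atlas_def by blast
  then show "\<exists>c. c \<in> charts_at A p"
    unfolding charts_at_def by blast
qed

lemma transition_differentiable:
  assumes A: "smooth_atlas M A" and cd: "c \<in> charts_at A p" "d \<in> charts_at A p"
  shows "transition c d differentiable (at (snd c p))"
proof (rule smooth_on_open_imp(2))
  show "smooth_on (snd c ` (fst c \<inter> fst d)) (transition c d)"
    using assms by (auto simp: smooth_atlas_def charts_at_def)
  show "open (snd c ` (fst c \<inter> fst d))"
    using smooth_atlas_chart[OF A cd(1)] smooth_atlas_chart[OF A cd(2)]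
    by (intro open_chart_image) (auto simp: is_chart_def)
  show "snd c p \<in> snd c ` (fst c \<inter> fst d)"
    using cd by (auto simp: charts_at_def)
qed

text \<open>The chain rule behind the transformation behaviour of tangent vectors.  The map \<open>\<phi>\<close> is an inverse
chart for \<open>coord_tvec_change_of_chart\<close>, and \<open>f\<close> after an inverse chart for the differential of \<open>f\<close>.\<close>

lemma change_of_chart_derivative:
  assumes A: "smooth_atlas M A" and d: "d \<in> charts_at A (\<phi> x)" "d' \<in> charts_at A (\<phi> x)"
    and diff: "(snd d \<circ> \<phi>) differentiable (at x)"
    and X: "open X" "x \<in> X" "\<And>y. y \<in> X \<Longrightarrow> \<phi> y \<in> fst d"
  shows "(snd d' \<circ> \<phi>) differentiable (at x)"
    and "frechet_derivative (snd d' \<circ> \<phi>) (at x) e =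
      frechet_derivative (transition d d') (at (snd d (\<phi> x))) (frechet_derivative (snd d \<circ> \<phi>) (at x) e)"
proof -
  have trans: "transition d d' differentiable (at ((snd d \<circ> \<phi>) x))"
    using transition_differentiable[OF A d] by simp
  have comp: "(transition d d' \<circ> (snd d \<circ> \<phi>)) differentiable (at x)"
    using differentiable_chain_at[OF diff trans] .
  have eq: "(transition d d' \<circ> (snd d \<circ> \<phi>)) y = (snd d' \<circ> \<phi>) y" if "y \<in> X" for y
    using chart_inv_inverse(1)[OF smooth_atlas_chart[OF A d(1)] X(3)[OF that]]
    by (simp add: transition_def)
  obtain D where "(transition d d' \<circ> (snd d \<circ> \<phi>) has_derivative D) (at x)"
    using comp unfolding differentiable_def by blast
  from has_derivative_transform_within_open[OF this X(1,2) eq]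
  show "(snd d' \<circ> \<phi>) differentiable (at x)"
    by (auto simp: differentiable_def o_def)
  show "frechet_derivative (snd d' \<circ> \<phi>) (at x) e =
      frechet_derivative (transition d d') (at (snd d (\<phi> x))) (frechet_derivative (snd d \<circ> \<phi>) (at x) e)"
    using frechet_derivative_transform_within_open[OF comp X(1,2) eq]
      frechet_derivative_compose[OF diff trans] by (metis o_apply)
qed

lemma coord_tvec_change_of_chart:
  assumes A: "smooth_atlas M A" and c: "c \<in> charts_at A p" and d: "d \<in> charts_at A p"
  shows "coord_tvec A d p (coord_tvec A c p e d) = coord_tvec A c p e"
proof
  fix d'
  show "coord_tvec A d p (coord_tvec A c p e d) d' = coord_tvec A c p e d'"
  proof (cases "d' \<in> charts_at A p")
    case True
    have chart: "is_chart M c" "is_chart M d"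
      using smooth_atlas_chart[OF A] c d by auto
    have p: "chart_inv c (snd c p) = p"
      using chart_inv_inverse(1)[OF chart(1)] c by (simp add: charts_at_def)
    let ?X = "snd c ` (fst c \<inter> fst d)"
    have "frechet_derivative (snd d' \<circ> chart_inv c) (at (snd c p)) e =
      frechet_derivative (transition d d') (at (snd d (chart_inv c (snd c p))))
        (frechet_derivative (snd d \<circ> chart_inv c) (at (snd c p)) e)"
    proof (rule change_of_chart_derivative(2)[OF A, where X = ?X])
      show "(snd d \<circ> chart_inv c) differentiable (at (snd c p))"
        using transition_differentiable[OF A c d] by (simp add: transition_def)
      show "open ?X"
        using chart by (intro open_chart_image[OF chart(1)]) (simp add: is_chart_def)
      show "snd c p \<in> ?X"
        using c d by (auto simp: charts_at_def)
      show "chart_inv c y \<in> fst d" if "y \<in> ?X" for y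
        using that chart_inv_inverse(1)[OF chart(1)] by auto
    qed (use d True p in simp_all)
    then show ?thesis
      using True d p by (simp add: coord_tvec_def transition_def)
  qed (simp add: coord_tvec_def)
qed

lemma coord_tvec_self:
  assumes A: "smooth_atlas M A" and c: "c \<in> charts_at A p"
  shows "coord_tvec A c p e c = e"
proof -
  have chart: "is_chart M c"
    using smooth_atlas_chart[OF A c] .
  have "frechet_derivative id (at (snd c p)) = frechet_derivative (transition c c) (at (snd c p))"
  proof (rule frechet_derivative_transform_within_open)
    show "open (snd c ` fst c)"
      using chart by (simp add: is_chart_def)
    show "id differentiable (at (snd c p))"
      unfolding id_def by simp
  qed (use c chart_inv_inverse[OF chart] in \<open>auto simp: transition_def charts_at_def\<close>)
  then have "frechet_derivative (transition c c) (at (snd c p)) e = e"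
    by (metis frechet_derivative_id id_apply)
  then show ?thesis
    using c by (simp add: coord_tvec_def)
qed

lemma coord_tvec_in_tangent_space:
  assumes A: "smooth_atlas M A" and c: "c \<in> charts_at A p"
  shows "coord_tvec A c p e \<in> tangent_space A p"
proof -
  have "coord_tvec A c p e d' =
      frechet_derivative (transition d d') (at (snd d p)) (coord_tvec A c p e d)"
    if "d \<in> charts_at A p" "d' \<in> charts_at A p" for d d'
    using fun_cong[OF coord_tvec_change_of_chart[OF A c that(1), of e], of d'] that(2)
    by (simp only: coord_tvec_def[of A d] if_True)
  moreover have "coord_tvec A c p e d = 0" if "d \<notin> charts_at A p" for d
    using that by (simp add: coord_tvec_def)
  ultimately show ?thesis
    unfolding tangent_space_def by blast
qed

text \<open>Together with \<open>coord_tvec_self\<close> and \<open>coord_tvec_linear\<close>, this identifies the tangent space at \<open>p\<close> with the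
model space, which turns pointwise statements about forms into linear algebra there.\<close>

lemma tangent_space_coord:
  assumes "c \<in> charts_at A p" and "v \<in> tangent_space A p"
  shows "coord_tvec A c p (v c) = v"
proof
  fix d
  have "v d = (if d \<in> charts_at A p then frechet_derivative (transition c d) (at (snd c p)) (v c) else 0)"
    using assms unfolding tangent_space_def by (cases "d \<in> charts_at A p") (simp only: if_True if_False, blast)+
  then show "coord_tvec A c p (v c) d = v d"
    by (simp only: coord_tvec_def)
qed

lemma coord_tvec_linear:
  assumes "smooth_atlas M A" and "c \<in> charts_at A p"
  shows "coord_tvec A c p (a *\<^sub>R e + b *\<^sub>R e') =
    (\<lambda>d. a *\<^sub>R coord_tvec A c p e d + b *\<^sub>R coord_tvec A c p e' d)"
  using linear_frechet_derivative[OF transition_differentiable[OF assms]]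
  by (auto simp: coord_tvec_def linear_add linear_scale)

section \<open>The differential of a smooth map\<close>

text \<open>The definition of the differential spells out every chart around \<open>f p\<close>; it suffices to know one.
The chart \<open>c\<close> at the source has to be the one chosen in that definition.\<close>

lemma differential_eq_coord_tvec:
  assumes A: "smooth_atlas M A" and f: "smooth_map M A f" and p: "p \<in> topspace M"
    and d: "d \<in> charts_at A (f p)"
  defines "c \<equiv> (SOME c. c \<in> charts_at A p)"
  shows "differential A f p v =
      coord_tvec A d (f p) (frechet_derivative (snd d \<circ> f \<circ> chart_inv c) (at (snd c p)) (v c))"
    and "(snd d \<circ> f \<circ> chart_inv c) differentiable (at (snd c p))"
proof -
  have c: "c \<in> charts_at A p"
    unfolding c_def by (rule charts_at_nonempty[OF A p])
  have chart: "is_chart M c" "is_chart M d"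
    using smooth_atlas_chart[OF A] c d by auto
  have pc: "chart_inv c (snd c p) = p" "p \<in> fst c"
    using chart_inv_inverse(1)[OF chart(1)] c by (auto simp: charts_at_def)
  let ?X = "{x \<in> snd c ` fst c. f (chart_inv c x) \<in> fst d}"
  have X: "open ?X"
    using open_chart_preimage[OF chart] f by (simp add: smooth_map_def)
  have xX: "snd c p \<in> ?X"
    using pc d by (simp add: charts_at_def)
  show diff: "(snd d \<circ> f \<circ> chart_inv c) differentiable (at (snd c p))"
    using f c d xX by (intro smooth_on_open_imp(2)[OF _ X]) (auto simp: smooth_map_def charts_at_def)
  have "frechet_derivative (snd d' \<circ> f \<circ> chart_inv c) (at (snd c p)) (v c) =
      frechet_derivative (transition d d') (at (snd d (f p)))
        (frechet_derivative (snd d \<circ> f \<circ> chart_inv c) (at (snd c p)) (v c))"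
    if "d' \<in> charts_at A (f p)" for d'
    using change_of_chart_derivative(2)[OF A, of d "f \<circ> chart_inv c" "snd c p" d' ?X "v c"]
      d that diff X xX pc by (simp add: o_assoc)
  then show "differential A f p v =
      coord_tvec A d (f p) (frechet_derivative (snd d \<circ> f \<circ> chart_inv c) (at (snd c p)) (v c))"
    unfolding differential_def coord_tvec_def Let_def c_def[symmetric] by auto
qed

lemma differential_in_tangent_space:
  assumes "smooth_atlas M A" and "smooth_map M A f" and "p \<in> topspace M"
  shows "differential A f p v \<in> tangent_space A (f p)"
proof -
  have "f p \<in> topspace M"
    using assms(2,3) by (auto simp: smooth_map_def continuous_map_def)
  from charts_at_nonempty[OF assms(1) this] show ?thesis
    using differential_eq_coord_tvec(1)[OF assms] coord_tvec_in_tangent_space[OF assms(1)] by metis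
qed

lemma differential_linear:
  assumes A: "smooth_atlas M A" and f: "smooth_map M A f" and p: "p \<in> topspace M"
  shows "differential A f p (\<lambda>d. a *\<^sub>R u d + b *\<^sub>R w d) =
    (\<lambda>d. a *\<^sub>R differential A f p u d + b *\<^sub>R differential A f p w d)"
proof -
  have "f p \<in> topspace M"
    using f p by (auto simp: smooth_map_def continuous_map_def)
  then obtain d where d: "d \<in> charts_at A (f p)"
    using charts_at_nonempty[OF A] by blast
  show ?thesis
    using linear_frechet_derivative[OF differential_eq_coord_tvec(2)[OF A f p d]]
    by (simp add: differential_eq_coord_tvec(1)[OF A f p d] coord_tvec_linear[OF A d]
        linear_add linear_scale)
qed

section \<open>Two-forms as bilinear maps\<close>

definition vec_pair :: "'v \<Rightarrow> 'v \<Rightarrow> nat \<Rightarrow> 'v" where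
  "vec_pair u w = (\<lambda>i. if i = 0 then u else w)"

lemma alternating_form_rules:
  assumes "alternating_form A k p \<eta>"
  shows "(\<And>i. i < k \<Longrightarrow> v i = w i) \<Longrightarrow> \<eta> v = \<eta> w"
    and "(\<And>i. i < k \<Longrightarrow> v i \<in> tangent_space A p) \<Longrightarrow> i < k \<Longrightarrow>
      x \<in> tangent_space A p \<Longrightarrow> y \<in> tangent_space A p \<Longrightarrow>
      \<eta> (v(i := (\<lambda>c. a *\<^sub>R x c + b *\<^sub>R y c))) = a * \<eta> (v(i := x)) + b * \<eta> (v(i := y))"
    and "(\<And>i. i < k \<Longrightarrow> v i \<in> tangent_space A p) \<Longrightarrow> i < k \<Longrightarrow> j < k \<Longrightarrow> i \<noteq> j \<Longrightarrow>
      v i = v j \<Longrightarrow> \<eta> v = 0"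
proof -
  note * = assms[unfolded alternating_form_def]
  show "(\<And>i. i < k \<Longrightarrow> v i = w i) \<Longrightarrow> \<eta> v = \<eta> w"
    using conjunct1[OF *] by simp
  show "\<eta> (v(i := (\<lambda>c. a *\<^sub>R x c + b *\<^sub>R y c))) = a * \<eta> (v(i := x)) + b * \<eta> (v(i := y))"
    if "\<And>i. i < k \<Longrightarrow> v i \<in> tangent_space A p" "i < k" "x \<in> tangent_space A p" "y \<in> tangent_space A p"
    using conjunct1[OF mp[OF spec[OF conjunct2[OF *], of v]]] that by simp
  show "\<eta> v = 0"
    if "\<And>i. i < k \<Longrightarrow> v i \<in> tangent_space A p" "i < k" "j < k" "i \<noteq> j" "v i = v j"
    using conjunct2[OF mp[OF spec[OF conjunct2[OF *], of v]]] that by metis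
qed

lemma alternating_form_2_vec_pair:
  assumes "alternating_form A 2 p \<eta>"
  shows "\<eta> v = \<eta> (vec_pair (v 0) (v 1))"
  by (rule alternating_form_rules(1)[OF assms]) (auto simp: vec_pair_def less_2_cases_iff)

text \<open>The map \<open>T\<close> will be a parametrization of the tangent space by the model space, possibly followed by a
differential.\<close>

lemma alternating_form_2_bilinear:
  fixes T :: "'e::euclidean_space \<Rightarrow> ('a, 'e) tvec"
  assumes \<eta>: "alternating_form A 2 p \<eta>" and T: "\<And>x. T x \<in> tangent_space A p"
    and lin: "\<And>a b x y. T (a *\<^sub>R x + b *\<^sub>R y) = (\<lambda>d. a *\<^sub>R T x d + b *\<^sub>R T y d)"
  shows "alternating_bilinear (\<lambda>x y. \<eta> (vec_pair (T x) (T y)))"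
proof -
  have T2: "vec_pair (T x) (T y) i \<in> tangent_space A p" for x y i
    using T by (simp add: vec_pair_def)
  have upd: "\<eta> ((vec_pair u w)(0 := u')) = \<eta> (vec_pair u' w)"
    "\<eta> ((vec_pair u w)(1 := w')) = \<eta> (vec_pair u w')" for u w u' w'
    by (rule alternating_form_rules(1)[OF \<eta>]; simp add: vec_pair_def)+
  have ml: "\<eta> ((vec_pair (T x) (T y))(i := (\<lambda>c. a *\<^sub>R T u c + b *\<^sub>R T w c))) =
      a * \<eta> ((vec_pair (T x) (T y))(i := T u)) + b * \<eta> ((vec_pair (T x) (T y))(i := T w))"
    if "i < 2" for i a b x y u w
    by (intro alternating_form_rules(2)[OF \<eta>] T2 T that)
  have alt: "\<eta> (vec_pair (T x) (T x)) = 0" for x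
    by (rule alternating_form_rules(3)[OF \<eta>, of _ 0 1]) (simp_all add: T vec_pair_def)
  have 0: "\<eta> (vec_pair (T (a *\<^sub>R u + b *\<^sub>R w)) (T y)) = a * \<eta> (vec_pair (T u) (T y)) + b * \<eta> (vec_pair (T w) (T y))"
    and 1: "\<eta> (vec_pair (T y) (T (a *\<^sub>R u + b *\<^sub>R w))) = a * \<eta> (vec_pair (T y) (T u)) + b * \<eta> (vec_pair (T y) (T w))"
    for a b u w y
    using ml[of 0 y y a u b w] ml[of 1 y y a u b w] unfolding upd lin by simp_all
  show ?thesis
    unfolding alternating_bilinear_def
  proof (intro conjI allI linearI)
    fix x y z :: 'e and r :: real
    show "\<eta> (vec_pair (T x) (T (y + z))) = \<eta> (vec_pair (T x) (T y)) + \<eta> (vec_pair (T x) (T z))"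
      using 1[of x 1 y 1 z] by simp
    show "\<eta> (vec_pair (T x) (T (r *\<^sub>R y))) = r *\<^sub>R \<eta> (vec_pair (T x) (T y))"
      using 1[of x r y 0 0] by simp
    show "\<eta> (vec_pair (T (y + z)) (T x)) = \<eta> (vec_pair (T y) (T x)) + \<eta> (vec_pair (T z) (T x))"
      using 0[of 1 y 1 z x] by simp
    show "\<eta> (vec_pair (T (r *\<^sub>R y)) (T x)) = r *\<^sub>R \<eta> (vec_pair (T y) (T x))"
      using 0[of r y 0 0 x] by simp
  qed (rule alt)
qed

lemma wedge_power_eq_gram_power:
  assumes "alternating_form A 2 p (\<omega> p)"
  shows "wedge_power \<omega> k p v = gram_power k (\<lambda>i j. \<omega> p (vec_pair (v i) (v j)))"
proof (induction k arbitrary: v)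
  case (Suc k)
  have "\<omega> p (\<lambda>i. v (\<sigma> i)) = \<omega> p (vec_pair (v (\<sigma> 0)) (v (\<sigma> 1)))" for \<sigma>
    by (rule alternating_form_2_vec_pair[OF assms])
  then show ?case
    by (simp add: wedge_def Suc)
qed simp

lemma pullback_vec_pair:
  "pullback A f \<omega> p (vec_pair u w) = \<omega> (f p) (vec_pair (differential A f p u) (differential A f p w))"
  by (simp add: pullback_def vec_pair_def if_distrib)

section \<open>Diffeomorphisms preserving a power of the symplectic form\<close>

lemma pullback_two_form_bilinear:
  assumes A: "smooth_atlas M A" and \<omega>: "differential_form M A 2 \<omega>" and f: "smooth_map M A f"
    and p: "p \<in> topspace M" and c: "c \<in> charts_at A p"
  shows "alternating_bilinear (\<lambda>x y. pullback A f \<omega> p (vec_pair (coord_tvec A c p x) (coord_tvec A c p y)))"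
  unfolding pullback_vec_pair
proof (rule alternating_form_2_bilinear)
  have "f p \<in> topspace M"
    using f p by (auto simp: smooth_map_def continuous_map_def)
  then show "alternating_form A 2 (f p) (\<omega> (f p))"
    using \<omega> by (simp add: differential_form_def)
  show "differential A f p (coord_tvec A c p x) \<in> tangent_space A (f p)" for x
    by (rule differential_in_tangent_space[OF A f p])
  show "differential A f p (coord_tvec A c p (a *\<^sub>R x + b *\<^sub>R y)) =
      (\<lambda>d. a *\<^sub>R differential A f p (coord_tvec A c p x) d + b *\<^sub>R differential A f p (coord_tvec A c p y) d)" for a b x y
    unfolding coord_tvec_linear[OF A c] by (rule differential_linear[OF A f p])
qed

lemma two_form_bilinear:
  assumes A: "smooth_atlas M A" and \<omega>: "differential_form M A 2 \<omega>"
    and p: "p \<in> topspace M" and c: "c \<in> charts_at A p"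
  shows "alternating_bilinear (\<lambda>x y. \<omega> p (vec_pair (coord_tvec A c p x) (coord_tvec A c p y)))"
proof (rule alternating_form_2_bilinear)
  show "alternating_form A 2 p (\<omega> p)"
    using \<omega> p by (simp add: differential_form_def)
qed (use coord_tvec_in_tangent_space[OF A c] coord_tvec_linear[OF A c] in auto)

text \<open>The linear algebra above, transported to the tangent space at \<open>p\<close> by a chart.\<close>

lemma pullback_abs_eq:
  fixes A :: "('a, 'e::euclidean_space) chart set"
  assumes sympl: "symplectic_manifold M A \<omega>" and k: "0 < k" "2 * k + 2 \<le> DIM('e)"
    and f: "f \<in> Diff M A (2 * k) (wedge_power \<omega> k)"
    and p: "p \<in> topspace M" and uw: "u \<in> tangent_space A p" "w \<in> tangent_space A p"
  shows "\<bar>pullback A f \<omega> p (vec_pair u w)\<bar> = \<bar>\<omega> p (vec_pair u w)\<bar>"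
proof -
  have A: "smooth_atlas M A" and \<omega>: "differential_form M A 2 \<omega>" and nd: "nondegenerate M A \<omega>"
    using sympl by (auto simp: symplectic_manifold_def smooth_manifold_def)
  have sm: "smooth_map M A f" and eq: "form_eq M A (2 * k) (pullback A f (wedge_power \<omega> k)) (wedge_power \<omega> k)"
    using f by (auto simp: Diff_def diffeomorphism_def)
  have fp: "f p \<in> topspace M"
    using sm p by (auto simp: smooth_map_def continuous_map_def)
  have alt: "alternating_form A 2 q (\<omega> q)" if "q \<in> topspace M" for q
    using \<omega> that by (simp add: differential_form_def)
  define c where "c = (SOME c. c \<in> charts_at A p)"
  have c: "c \<in> charts_at A p"
    unfolding c_def by (rule charts_at_nonempty[OF A p])
  let ?T = "coord_tvec A c p"
  let ?\<alpha> = "\<lambda>x y. \<omega> p (vec_pair (?T x) (?T y))"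
  let ?\<beta> = "\<lambda>x y. pullback A f \<omega> p (vec_pair (?T x) (?T y))"
  have "nondegenerate_bilinear ?\<alpha>"
    unfolding nondegenerate_bilinear_def
  proof (intro allI impI)
    fix x assume "\<forall>y. ?\<alpha> x y = 0"
    then have "\<omega> p (vec_pair (?T x) w) = 0" if "w \<in> tangent_space A p" for w
      using tangent_space_coord[OF c that] by (auto dest: spec[of _ "w c"])
    then have "?T x = (\<lambda>c. 0)"
      using nd p coord_tvec_in_tangent_space[OF A c, of x]
      by (simp add: nondegenerate_def vec_pair_def)
    then show "x = 0"
      using coord_tvec_self[OF A c, of x] by simp
  qed
  moreover have "gram_power k (\<lambda>i j. ?\<beta> (x i) (x j)) = gram_power k (\<lambda>i j. ?\<alpha> (x i) (x j))" for x
  proof -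
    have "pullback A f (wedge_power \<omega> k) p (\<lambda>i. ?T (x i)) = wedge_power \<omega> k p (\<lambda>i. ?T (x i))"
      using eq p coord_tvec_in_tangent_space[OF A c] by (simp add: form_eq_def)
    then show ?thesis
      unfolding pullback_vec_pair
      by (simp only: pullback_def wedge_power_eq_gram_power[where A = A and p = "f p" and \<omega> = \<omega>, OF alt[OF fp]] wedge_power_eq_gram_power[where A = A and p = p and \<omega> = \<omega>, OF alt[OF p]])
  qed
  ultimately have "\<bar>?\<beta> x y\<bar> = \<bar>?\<alpha> x y\<bar>" for x y
    by (intro plus_minus_if_gram_power_eq[OF two_form_bilinear[OF A \<omega> p c] _
          pullback_two_form_bilinear[OF A \<omega> sm p c] k])
  from this[of "u c" "w c"] show ?thesis
    unfolding tangent_space_coord[OF c uw(1)] tangent_space_coord[OF c uw(2)] .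
qed

lemma wedge_power_preserved:
  assumes \<omega>: "differential_form M A 2 \<omega>" and f: "f \<in> Diff M A 2 \<omega>"
  shows "f \<in> Diff M A (2 * k) (wedge_power \<omega> k)"
proof -
  have diffeo: "diffeomorphism M A f" and eq: "form_eq M A 2 (pullback A f \<omega>) \<omega>"
    using f by (auto simp: Diff_def)
  have "pullback A f (wedge_power \<omega> k) p v = wedge_power \<omega> k p v"
    if p: "p \<in> topspace M" and v: "\<forall>i<2 * k. v i \<in> tangent_space A p" for p v
  proof -
    have fp: "f p \<in> topspace M"
      using diffeo p by (auto simp: diffeomorphism_def smooth_map_def continuous_map_def)
    have alt: "alternating_form A 2 q (\<omega> q)" if "q \<in> topspace M" for q
      using \<omega> that by (simp add: differential_form_def)
    have "pullback A f (wedge_power \<omega> k) p v = gram_power k (\<lambda>i j. pullback A f \<omega> p (vec_pair (v i) (v j)))"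
      unfolding pullback_vec_pair
      by (simp only: pullback_def wedge_power_eq_gram_power[where A = A and p = "f p" and \<omega> = \<omega>, OF alt[OF fp]])
    also have "\<dots> = gram_power k (\<lambda>i j. \<omega> p (vec_pair (v i) (v j)))"
      using eq p v by (intro gram_power_cong) (simp add: form_eq_def vec_pair_def)
    also have "\<dots> = wedge_power \<omega> k p v"
      by (rule wedge_power_eq_gram_power[where A = A and p = p and \<omega> = \<omega>, OF alt[OF p], symmetric])
    finally show ?thesis .
  qed
  with diffeo show ?thesis
    by (simp add: Diff_def form_eq_def)
qed

section \<open>Continuity along an isotopy\<close>

lemma continuous_on_if_locally:
  fixes h :: "'a::t2_space \<Rightarrow> 'b::topological_space"
  assumes "\<And>t. t \<in> S \<Longrightarrow> \<exists>J. open J \<and> t \<in> J \<and> continuous_on (S \<inter> J) h"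
  shows "continuous_on S h"
  unfolding continuous_on_eq_continuous_within
proof
  fix t assume t: "t \<in> S"
  then obtain J where J: "open J" "t \<in> J" "continuous_on (S \<inter> J) h"
    using assms by blast
  then have "continuous (at t within S \<inter> J) h"
    using t by (simp add: continuous_on_eq_continuous_within)
  moreover have "at t within S \<inter> J = at t within S"
    using J by (intro at_within_nhd[of _ J]) auto
  ultimately show "continuous (at t within S) h"
    by simp
qed

text \<open>Smoothness of the family on the set \<open>U \<times> [0,1]\<close>, which is not open, provides near \<open>(p, t\<^sub>0)\<close> a smooth extension \<open>g\<close> to an
open set.  For fixed \<open>t\<close> the slice in the direction of \<open>U\<close> is open even at the ends of the
interval, so the derivative of \<open>f\<^sub>t\<close> in coordinates is the partial derivative of \<open>g\<close>, which is continuous in \<open>t\<close>.\<close>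

lemma smooth_family_local_extension:
  assumes A: "smooth_atlas M A" and F: "smooth_family M A F" and Ft: "\<And>t. t \<in> {0..1} \<Longrightarrow> smooth_map M A (F t)"
    and p: "p \<in> topspace M" and c: "c \<in> charts_at A p"
    and t0: "t0 \<in> {0..1}" and d: "d \<in> charts_at A (F t0 p)"
  obtains J and x D where "open J" "t0 \<in> J" "continuous_on J x" "\<And>e. continuous_on J (\<lambda>t. D t e)"
    "\<And>t. t \<in> {0..1} \<inter> J \<Longrightarrow> F t p \<in> fst d \<and> x t = snd d (F t p)"
    "\<And>t. t \<in> {0..1} \<inter> J \<Longrightarrow> D t = frechet_derivative (snd d \<circ> F t \<circ> chart_inv c) (at (snd c p))"
proof -
  have chart: "is_chart M c" "is_chart M d"
    using smooth_atlas_chart[OF A] c d by auto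
  have pc: "chart_inv c (snd c p) = p" "p \<in> fst c"
    using chart_inv_inverse(1)[OF chart(1)] c by (auto simp: charts_at_def)
  let ?x0 = "snd c p"
  let ?S = "{(x, t). x \<in> snd c ` fst c \<and> t \<in> {0..1} \<and> F t (chart_inv c x) \<in> fst d}"
  let ?E = "\<lambda>(x, t). snd d (F t (chart_inv c x))"
  have smooth: "smooth_on ?S ?E"
    using F c d by (simp add: smooth_family_def charts_at_def)
  have base: "(?x0, t0) \<in> ?S"
    using pc t0 d by (simp add: charts_at_def)
  obtain T g where T: "open T" "(?x0, t0) \<in> T" and Ck: "\<forall>k. Ck_on k T g"
    and eq: "\<forall>y\<in>?S \<inter> T. g y = ?E y"
    using bspec[OF smooth[unfolded smooth_on_def] base] by (elim exE conjE)
  have g: "Ck_on k T g" for k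
    using Ck by (rule spec)
  have gF: "g (y, t) = snd d (F t (chart_inv c y))"
    if "y \<in> snd c ` fst c" "t \<in> {0..1}" "F t (chart_inv c y) \<in> fst d" "(y, t) \<in> T" for y t
    using bspec[OF eq, of "(y, t)"] that by simp
  have "continuous_map (top_of_set {0..1}) M ((\<lambda>(x, t). F t x) \<circ> (\<lambda>t. (p, t)))"
  proof (rule continuous_map_compose)
    show "continuous_map (top_of_set {0..1}) (prod_topology M (top_of_set {0..1})) (\<lambda>t. (p, t))"
      using p by (simp add: continuous_map_paired)
    show "continuous_map (prod_topology M (top_of_set {0..1})) M (\<lambda>(x, t). F t x)"
      using F by (simp add: smooth_family_def)
  qed
  then have "continuous_map (top_of_set {0..1}) M (\<lambda>t. F t p)"
    by (simp add: o_def)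
  then have "openin (top_of_set {0..1}) {t \<in> topspace (top_of_set {0..1}). F t p \<in> fst d}"
    by (rule openin_continuous_map_preimage) (use chart(2) in \<open>simp add: is_chart_def\<close>)
  then obtain V where V: "open V" "{t \<in> {0..1}. F t p \<in> fst d} = {0..1} \<inter> V"
    by (auto simp: openin_open)
  define J where "J = V \<inter> (\<lambda>t. (?x0, t)) -` T"
  have J: "(?x0, t) \<in> T" if "t \<in> J" for t
    using that by (simp add: J_def)
  have FJ: "F t p \<in> fst d" if "t \<in> {0..1} \<inter> J" for t
  proof -
    have "t \<in> {0..1} \<inter> V"
      using that by (simp add: J_def)
    then show ?thesis
      unfolding V(2)[symmetric] by simp
  qed
  have g_diff: "g differentiable (at z)" if "z \<in> T" for z
    using g[of "Suc 0"] that by simp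
  have g_cont: "continuous_on T (\<lambda>z. frechet_derivative g (at z) v)" for v
    using g[of "Suc 0"] by (cases v) simp
  have slice: "open {x. (x, t) \<in> T}" for t
  proof -
    have "open ((\<lambda>x. (x, t)) -` T)"
      by (intro open_vimage T continuous_intros)
    then show ?thesis by (simp add: vimage_def)
  qed
  show thesis
  proof
    show "open J"
      unfolding J_def by (intro open_Int V(1) open_vimage T(1) continuous_intros)
    have "t0 \<in> {t \<in> {0..1}. F t p \<in> fst d}"
      using t0 d by (simp add: charts_at_def)
    then have "t0 \<in> V"
      unfolding V(2) by simp
    then show "t0 \<in> J"
      using T(2) by (simp add: J_def)
    have "continuous_on T g"
      using g[of 0] by simp
    then show "continuous_on J (\<lambda>t. g (?x0, t))"
      by (rule continuous_on_compose2) (auto intro!: continuous_intros J)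
    show "continuous_on J (\<lambda>t. frechet_derivative g (at (?x0, t)) (e, 0))" for e
      by (rule continuous_on_compose2[OF g_cont]) (auto intro!: continuous_intros J)
    fix t assume t: "t \<in> {0..1} \<inter> J"
    show "F t p \<in> fst d \<and> g (?x0, t) = snd d (F t p)"
      using gF[of ?x0 t] FJ[OF t] pc t J by simp
    let ?X = "{x \<in> snd c ` fst c. F t (chart_inv c x) \<in> fst d} \<inter> {x. (x, t) \<in> T}"
    have "open ?X"
      using Ft[of t] t by (intro open_Int slice open_chart_preimage[OF chart]) (auto simp: smooth_map_def)
    have "((\<lambda>x. (x, t)) has_derivative (\<lambda>e. (e, 0))) (at ?x0)"
      by (auto intro!: derivative_eq_intros)
    moreover have "(g has_derivative frechet_derivative g (at (?x0, t))) (at (?x0, t))"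
      using g_diff[OF J] t by (simp add: frechet_derivative_works[symmetric])
    ultimately have "(g \<circ> (\<lambda>x. (x, t)) has_derivative frechet_derivative g (at (?x0, t)) \<circ> (\<lambda>e. (e, 0))) (at ?x0)"
      by (rule diff_chain_at)
    moreover have "(g \<circ> (\<lambda>x. (x, t))) y = (snd d \<circ> F t \<circ> chart_inv c) y" if "y \<in> ?X" for y
      using gF[of y t] that t by simp
    moreover have "?x0 \<in> ?X"
      using FJ[OF t] J t pc by auto
    ultimately have "(snd d \<circ> F t \<circ> chart_inv c has_derivative frechet_derivative g (at (?x0, t)) \<circ> (\<lambda>e. (e, 0))) (at ?x0)"
      using \<open>open ?X\<close> has_derivative_transform_within_open[of "g \<circ> (\<lambda>x. (x, t))" _ ?x0 UNIV ?X] by blast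
    from frechet_derivative_at[OF this]
    show "(\<lambda>e. frechet_derivative g (at (?x0, t)) (e, 0)) = frechet_derivative (snd d \<circ> F t \<circ> chart_inv c) (at ?x0)"
      by (simp add: o_def)
  qed
qed

text \<open>In a chart around \<open>F t\<^sub>0 p\<close> the pullback is a polynomial in the coefficients of \<open>\<omega>\<close> at the moving
point \<open>F t p\<close> and the coordinates of the moving vectors, all of which are continuous.\<close>

lemma pullback_continuous_in_time:
  assumes A: "smooth_atlas M A" and \<omega>: "differential_form M A 2 \<omega>" and F: "smooth_family M A F"
    and Ft: "\<And>t. t \<in> {0..1} \<Longrightarrow> smooth_map M A (F t)" and p: "p \<in> topspace M"
  shows "continuous_on {0..1} (\<lambda>t. pullback A (F t) \<omega> p (vec_pair u w))"
proof (rule continuous_on_if_locally)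
  fix t0 :: real assume t0: "t0 \<in> {0..1}"
  have Fp: "F t p \<in> topspace M" if "t \<in> {0..1}" for t
    using Ft[OF that] p by (auto simp: smooth_map_def continuous_map_def)
  define c where "c = (SOME c. c \<in> charts_at A p)"
  have c: "c \<in> charts_at A p"
    unfolding c_def by (rule charts_at_nonempty[OF A p])
  obtain d where d: "d \<in> charts_at A (F t0 p)"
    using charts_at_nonempty[OF A Fp[OF t0]] by blast
  have dA: "d \<in> A"
    using d by (simp add: charts_at_def)
  have chart: "is_chart M d"
    using smooth_atlas_chart[OF A d] .
  obtain J x D where J: "open J" "t0 \<in> J" and cont: "continuous_on J x" "\<And>e. continuous_on J (\<lambda>t. D t e)"
    and x: "\<And>t. t \<in> {0..1} \<inter> J \<Longrightarrow> F t p \<in> fst d \<and> x t = snd d (F t p)"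
    and D: "\<And>t. t \<in> {0..1} \<inter> J \<Longrightarrow> D t = frechet_derivative (snd d \<circ> F t \<circ> chart_inv c) (at (snd c p))"
    using smooth_family_local_extension[OF A F Ft p c t0 d] by blast
  let ?l = "\<lambda>y a b. local_form A d \<omega> y (vec_pair a b)"
  have expand: "pullback A (F t) \<omega> p (vec_pair u w) =
      (\<Sum>i\<in>Basis. \<Sum>j\<in>Basis. (D t (u c) \<bullet> i) * (D t (w c) \<bullet> j) * ?l (x t) i j)"
    if t: "t \<in> {0..1} \<inter> J" for t
  proof -
    have q: "F t p \<in> topspace M" "d \<in> charts_at A (F t p)" "smooth_map M A (F t)"
      using Fp Ft x[OF t] t dA by (auto simp: charts_at_def)
    have xq: "chart_inv d (x t) = F t p"
      using x[OF t] chart_inv_inverse(1)[OF chart] by simp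
    have l: "?l (x t) a b = \<omega> (F t p) (vec_pair (coord_tvec A d (F t p) a) (coord_tvec A d (F t p) b))" for a b
      by (simp add: local_form_def xq vec_pair_def if_distrib)
    have "differential A (F t) p v = coord_tvec A d (F t p) (D t (v c))" for v
      using differential_eq_coord_tvec(1)[OF A q(3) p q(2)] D[OF t] unfolding c_def by simp
    then have "pullback A (F t) \<omega> p (vec_pair u w) = ?l (x t) (D t (u c)) (D t (w c))"
      by (simp add: pullback_vec_pair l)
    also have "\<dots> = (\<Sum>i\<in>Basis. \<Sum>j\<in>Basis. (D t (u c) \<bullet> i) * (D t (w c) \<bullet> j) * ?l (x t) i j)"
      unfolding l by (rule alternating_bilinear_expand[OF two_form_bilinear[OF A \<omega> q(1,2)]])
    finally show ?thesis .
  qed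
  have lcont': "continuous_on (snd d ` fst d) (\<lambda>y. ?l y i j)" for i j
    using \<omega> dA chart by (intro smooth_on_open_imp(1)) (auto simp: differential_form_def is_chart_def)
  have lcont: "continuous_on ({0..1} \<inter> J) (\<lambda>t. ?l (x t) i j)" for i j
  proof (rule continuous_on_compose2[OF lcont'])
    show "continuous_on ({0..1} \<inter> J) x"
      using continuous_on_subset[OF cont(1)] by blast
    show "x ` ({0..1} \<inter> J) \<subseteq> snd d ` fst d"
      using x by blast
  qed
  have "continuous_on ({0..1} \<inter> J) (\<lambda>t. D t e)" for e
    using continuous_on_subset[OF cont(2)] by blast
  with lcont have "continuous_on ({0..1} \<inter> J) (\<lambda>t. \<Sum>i\<in>Basis. \<Sum>j\<in>Basis. (D t (u c) \<bullet> i) * (D t (w c) \<bullet> j) * ?l (x t) i j)"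
    by (intro continuous_intros)
  then have "continuous_on ({0..1} \<inter> J) (\<lambda>t. pullback A (F t) \<omega> p (vec_pair u w))"
    by (rule continuous_on_eq) (simp only: expand)
  with J show "\<exists>J. open J \<and> t0 \<in> J \<and> continuous_on ({0..1} \<inter> J) (\<lambda>t. pullback A (F t) \<omega> p (vec_pair u w))"
    by blast
qed

lemma continuous_abs_constant:
  fixes h :: "real \<Rightarrow> real"
  assumes cont: "continuous_on {0..1} h" and abs: "\<And>t. t \<in> {0..1} \<Longrightarrow> \<bar>h t\<bar> = \<bar>C\<bar>" and "h 0 = C"
    and t: "t \<in> {0..1}"
  shows "h t = C"
proof (rule ccontr)
  assume "h t \<noteq> C"
  have ct: "continuous_on {0..t} h"
    using continuous_on_subset[OF cont] t by auto
  have "h t = - C" "C \<noteq> 0"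
    using abs[OF t] \<open>h t \<noteq> C\<close> by auto
  then have "\<exists>s. 0 \<le> s \<and> s \<le> t \<and> h s = 0"
    using IVT'[OF _ _ _ ct, of 0] IVT2'[OF _ _ _ ct, of 0] \<open>h 0 = C\<close> t by (cases "C > 0") auto
  then obtain s where "s \<in> {0..1}" "h s = 0"
    using t by fastforce
  with abs[of s] \<open>C \<noteq> 0\<close> show False by simp
qed

lemma differential_identity:
  assumes A: "smooth_atlas M A" and p: "p \<in> topspace M" and v: "v \<in> tangent_space A p"
  shows "differential A (restrict id (topspace M)) p v = v"
proof -
  define c where "c = (SOME c. c \<in> charts_at A p)"
  have c: "c \<in> charts_at A p"
    unfolding c_def by (rule charts_at_nonempty[OF A p])
  have chart: "is_chart M c"
    using smooth_atlas_chart[OF A c] .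
  have "frechet_derivative (snd d \<circ> restrict id (topspace M) \<circ> chart_inv c) (at (snd c p)) =
      frechet_derivative (transition c d) (at (snd c p))" if d: "d \<in> charts_at A p" for d
  proof (rule sym, rule frechet_derivative_transform_within_open[OF transition_differentiable[OF A c d]])
    show "open (snd c ` fst c)"
      using chart by (simp add: is_chart_def)
    show "snd c p \<in> snd c ` fst c"
      using c by (simp add: charts_at_def)
    show "transition c d x = (snd d \<circ> restrict id (topspace M) \<circ> chart_inv c) x" if "x \<in> snd c ` fst c" for x
      using chart_inv_inverse(3)[OF chart that] chart openin_subset[of M "fst c"]
      by (auto simp: transition_def is_chart_def)
  qed
  then have "differential A (restrict id (topspace M)) p v = coord_tvec A c p (v c)"
    using p unfolding differential_def coord_tvec_def Let_def c_def[symmetric] by auto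
  then show ?thesis
    using tangent_space_coord[OF c v] by simp
qed

section \<open>Identity components\<close>

theorem theorem2:
  fixes M :: "'a topology"
    and A :: "('a, 'e::euclidean_space) chart set"
    and \<omega> :: "('a, 'e) form"
    and n k :: nat
  assumes "symplectic_manifold M A \<omega>"
    and "DIM('e) = 2 * n" and "n > 2"
    and "0 < k" and "k < n"
  shows "Diff0 M A (2 * k) (wedge_power \<omega> k) = Symp0 M A \<omega>"
proof
  have A: "smooth_atlas M A" and \<omega>: "differential_form M A 2 \<omega>"
    using assms(1) by (auto simp: symplectic_manifold_def smooth_manifold_def)
  show "Symp0 M A \<omega> \<subseteq> Diff0 M A (2 * k) (wedge_power \<omega> k)"
    using wedge_power_preserved[OF \<omega>] unfolding Symp0_def Diff0_def by blast
  have "F t \<in> Diff M A 2 \<omega>"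
    if F: "smooth_family M A F" and Ft: "\<forall>t\<in>{0..1}. F t \<in> Diff M A (2 * k) (wedge_power \<omega> k)"
      and F0: "F 0 = restrict id (topspace M)" and t: "t \<in> {0..1}" for F t
  proof -
    have diffeo: "diffeomorphism M A (F t)" if "t \<in> {0..1}" for t
      using Ft that by (simp add: Diff_def)
    have "pullback A (F t) \<omega> p v = \<omega> p v"
      if p: "p \<in> topspace M" and v: "\<forall>i<2. v i \<in> tangent_space A p" for p v
    proof -
      have uw: "v 0 \<in> tangent_space A p" "v 1 \<in> tangent_space A p"
        using v by auto
      let ?h = "\<lambda>t. pullback A (F t) \<omega> p (vec_pair (v 0) (v 1))"
      have "?h t = \<omega> p (vec_pair (v 0) (v 1))"
      proof (rule continuous_abs_constant[OF _ _ _ t])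
        show "continuous_on {0..1} ?h"
          using diffeo by (intro pullback_continuous_in_time[OF A \<omega> F _ p]) (simp add: diffeomorphism_def)
        show "\<bar>?h t\<bar> = \<bar>\<omega> p (vec_pair (v 0) (v 1))\<bar>" if "t \<in> {0..1}" for t
          using assms Ft that by (intro pullback_abs_eq[OF assms(1) _ _ _ p uw]) auto
        show "?h 0 = \<omega> p (vec_pair (v 0) (v 1))"
          using p by (simp only: pullback_vec_pair F0 differential_identity[OF A p uw(1)]
              differential_identity[OF A p uw(2)]) simp
      qed
      moreover have "alternating_form A 2 q (\<omega> q)" if "q \<in> topspace M" for q
        using \<omega> that by (simp add: differential_form_def)
      moreover have "F t p \<in> topspace M"
        using diffeo[OF t] p by (auto simp: diffeomorphism_def smooth_map_def continuous_map_def)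
      ultimately show ?thesis
        using alternating_form_2_vec_pair[of A p "\<omega> p" v] p
          alternating_form_2_vec_pair[of A "F t p" "\<omega> (F t p)" "\<lambda>i. differential A (F t) p (v i)"]
        by (simp only: pullback_vec_pair) (simp add: pullback_def)
    qed
    with diffeo[OF t] show ?thesis
      by (simp add: Diff_def form_eq_def)
  qed
  note preserved = this
  show "Diff0 M A (2 * k) (wedge_power \<omega> k) \<subseteq> Symp0 M A \<omega>"
  proof
    fix f assume "f \<in> Diff0 M A (2 * k) (wedge_power \<omega> k)"
    then obtain F where F: "smooth_family M A F" "\<forall>t\<in>{0..1}. F t \<in> Diff M A (2 * k) (wedge_power \<omega> k)"
      "F 0 = restrict id (topspace M)" "F 1 = f"
      unfolding Diff0_def by blast
    have Ft: "F t \<in> Diff M A 2 \<omega>" if "t \<in> {0..1}" for t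
      using preserved[OF F(1-3) that] .
    from Ft[of 1] F(4) have "f \<in> Diff M A 2 \<omega>"
      by simp
    with F Ft show "f \<in> Symp0 M A \<omega>"
      unfolding Symp0_def Diff0_def by blast
  qed
qed

end
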